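(* Consider $T$ rounds of stochastic online generalized linear regression in $\mathbb{R}^d$ (as defined in the context), with $\|x_t\|_2\le A$ for all $t\in[T]$, $\|\mu^*\|_2\le B$, and activation function $\phi$ satisfying $0<\kappa\le\phi'(z)\le K$ for all $z\in[-B,B]$. Suppose the noise $\epsilon_1,\dots,\epsilon_T$ is a sequence of independent zero-mean random variables with $\mathbb{P}(|\epsilon_t|\le R)=1$ and $\mathbb{E}[\epsilon_t^2]\le\sigma^2$ for all $t$. Let $\hat\mu_1,\dots,\hat\mu_T$ be the iterates of the follow-the-regularized-leader algorithm (FTRL) with $\lambda=4A^2K^2/\kappa$. Then for every $\delta\in(0,1/2)$, with probability at least $1-2\delta$, $$\mathcal{R}^{\mathrm{stoc}}(T)\le \frac{6}{\kappa}\,\sigma^2 d\log\frac{4dK^2+T\kappa^2}{4dK^2}+\frac{8K^2A^2B^2}{\kappa}+2\left(\frac{2}{\kappa}+\frac{5\kappa}{24K^2}\right)R^2\log(1/\delta).$$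
   Context: Stochastic online generalized linear regression: $\phi:\mathbb{R}\to\mathbb{R}$ is a known activation function which is increasing and differentiable on $[-B,B]$, with constants $\kappa,K\in\mathbb{R}$ such that $0<\kappa\le\phi'(z)\le K$ for all $z\in[-B,B]$. There is an unknown $\mu^*\in\mathbb{R}^d$ with $\|\mu^*\|_2\le B$. At each round $t\in[T]=\{1,\dots,T\}$, the learner observes a feature vector $x_t\in\mathbb{R}^d$, $\|x_t\|_2\le A$, generated arbitrarily by the environment; it outputs a prediction $\hat y_t=\phi(\langle\hat\mu_t,x_t\rangle)$, where $\hat\mu_t$ is its estimate of $\mu^*$; then the label $y_t=\phi(\langle\mu^*,x_t\rangle)+\epsilon_t$, with $\epsilon_t$ a stochastic noise, is revealed. Loss: $\ell_t(\mu):=-x_t^\top\mu\,y_t+\int_0^{x_t^\top\mu}\phi(z)\,dz$. Stochastic regret: $\mathcal{R}^{\mathrm{stoc}}(T):=\sum_{t=1}^T\ell_t(\hat\mu_t)-\sum_{t=1}^T\ell_t(\mu^* )$. FTRL with parameter $\lambda>0$: $\hat\mu_1=0$ and $\hat\mu_{t+1}=\operatorname{argmin}_{\mu\in\mathbb{R}^d}\big(\lambda\|\mu\|_2^2+\sum_{\tau=1}^t\ell_\tau(\mu)\big)$ for $t\ge1$.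
   Formalization: The bounds κ ≤ φ' ≤ K are assumed on an interval D containing [-B,B] and all predictors ⟨μ*,x_t⟩ and ⟨μ̂_s,x_t⟩ (t ≤ s ≤ T); with bounds on [-B,B] alone the claim fails. Features and estimates depend only on the past, of which ε_t is independent. *)

theory Defs
  imports "HOL-Probability.Probability"
begin

definition glm_loss :: "(real \<Rightarrow> real) \<Rightarrow> real ^ 'n \<Rightarrow> real \<Rightarrow> real ^ 'n \<Rightarrow> real" where
  "glm_loss \<phi> x y \<mu> = - (x \<bullet> \<mu>) * y + (LBINT z=0..x \<bullet> \<mu>. \<phi> z)"

definition stoc_regret ::
  "(real \<Rightarrow> real) \<Rightarrow> (nat \<Rightarrow> real ^ 'n) \<Rightarrow> (nat \<Rightarrow> real) \<Rightarrow> (nat \<Rightarrow> real ^ 'n) \<Rightarrow> real ^ 'n \<Rightarrow> nat \<Rightarrow> real"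
where
  "stoc_regret \<phi> x y \<mu>hat \<mu>star T =
     (\<Sum>t=1..T. glm_loss \<phi> (x t) (y t) (\<mu>hat t)) - (\<Sum>t=1..T. glm_loss \<phi> (x t) (y t) \<mu>star)"

text \<open>Rounds are numbered from 1; only the iterates of rounds \<open>1, \<dots>, T\<close> are constrained.
  The minimisation is unconstrained, over the whole space.\<close>

definition ftrl_iterates ::
  "(real \<Rightarrow> real) \<Rightarrow> real \<Rightarrow> (nat \<Rightarrow> real ^ 'n) \<Rightarrow> (nat \<Rightarrow> real) \<Rightarrow> nat \<Rightarrow> (nat \<Rightarrow> real ^ 'n) \<Rightarrow> bool"
where
  "ftrl_iterates \<phi> lam x y T \<mu>hat \<longleftrightarrow>
     \<mu>hat 1 = 0 \<and>
     (\<forall>t\<in>{1..<T}. is_arg_min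
        (\<lambda>\<mu>. lam * (norm \<mu>)\<^sup>2 + (\<Sum>\<tau>=1..t. glm_loss \<phi> (x \<tau>) (y \<tau>) \<mu>)) (\<lambda>_. True) (\<mu>hat (t + 1)))"

text \<open>The interaction protocol. \<open>F t\<close> is the information available after round \<open>t\<close> (\<open>F 0\<close>:
  before the first round). The feature vector of round \<open>t\<close> is chosen by a possibly randomised and
  adaptive environment, and the estimate of round \<open>t\<close> by the learner, from the information of the
  preceding rounds, and the noise of round \<open>t\<close> is independent of that information. Constant
  (oblivious) feature vectors are the case where \<open>F t\<close> is generated by the noise of
  the rounds \<open>1, \<dots>, t\<close>.\<close>

definition online_protocol ::
  "'w measure \<Rightarrow> (nat \<Rightarrow> 'w measure) \<Rightarrow> nat \<Rightarrow> (nat \<Rightarrow> 'w \<Rightarrow> real ^ 'n) \<Rightarrow> (nat \<Rightarrow> 'w \<Rightarrow> real ^ 'n)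
    \<Rightarrow> (nat \<Rightarrow> 'w \<Rightarrow> real) \<Rightarrow> bool"
where
  "online_protocol M F T x \<mu>hat \<epsilon> \<longleftrightarrow>
     filtration (space M) F \<and> (\<forall>t. subalgebra M (F t)) \<and>
     (\<forall>t\<in>{1..T}.
        x t \<in> borel_measurable (F (t - 1)) \<and>
        \<mu>hat t \<in> borel_measurable (F (t - 1)) \<and>
        \<epsilon> t \<in> borel_measurable (F t) \<and>
        prob_space.indep_set M (sets (F (t - 1))) (sets (vimage_algebra (space M) (\<epsilon> t) borel)))"

text \<open>Bounds on \<open>\<phi>'\<close> on \<open>[-B, B]\<close> alone say nothing about \<open>\<phi>\<close> at the arguments
  \<open>\<langle>\<mu>star, x t\<rangle>\<close> (which range over \<open>[-A * B, A * B]\<close>) and \<open>\<langle>\<mu>hat s, x t\<rangle>\<close> (the iterates are not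
  constrained). The bounds are therefore required on an interval \<open>D\<close> that contains \<open>[-B, B]\<close> and
  the linear predictors that occur (\<open>predictors_in\<close>); \<open>D\<close> may be \<open>[-B, B]\<close>, or the whole line, where
  \<open>predictors_in\<close> holds trivially. The derivative is taken within \<open>D\<close>, so it is one-sided at an
  end point of \<open>D\<close>.\<close>

definition activation_on :: "real set \<Rightarrow> (real \<Rightarrow> real) \<Rightarrow> (real \<Rightarrow> real) \<Rightarrow> real \<Rightarrow> real \<Rightarrow> bool" where
  "activation_on D \<phi> \<phi>' \<kappa> K \<longleftrightarrow>
     0 < \<kappa> \<and>
     (\<forall>z\<in>D. (\<phi> has_real_derivative \<phi>' z) (at z within D) \<and> \<kappa> \<le> \<phi>' z \<and> \<phi>' z \<le> K)"

definition predictors_in ::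
  "real set \<Rightarrow> nat \<Rightarrow> (nat \<Rightarrow> real ^ 'n) \<Rightarrow> (nat \<Rightarrow> real ^ 'n) \<Rightarrow> real ^ 'n \<Rightarrow> bool"
where
  "predictors_in D T x \<mu>hat \<mu>star \<longleftrightarrow>
     (\<forall>t\<in>{1..T}. \<mu>star \<bullet> x t \<in> D \<and> (\<forall>s\<in>{t..T}. \<mu>hat s \<bullet> x t \<in> D))"

end

theory Submission
  imports Defs
begin

text \<open>
  Strong convexity and the optimality of each iterate bound the regret by
  \<open>\<lambda> \<parallel>\<mu>\<^sup>*\<parallel>\<^sup>2 + (1 / 2\<kappa>) \<Sum>\<^sub>t (\<phi>(\<langle>\<mu>\<^sub>t, x\<^sub>t\<rangle>) - y\<^sub>t)\<^sup>2 w\<^sub>t\<close>, where \<open>w\<^sub>t\<close> is the leverage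
  of \<open>x\<^sub>t\<close> in the regularized Gram matrix. The choice of \<open>\<lambda>\<close> makes \<open>w\<^sub>t \<le> \<kappa>\<^sup>2 / 8K\<^sup>2\<close>, so that the part of
  the residual due to the prediction error \<open>q\<^sub>t = \<langle>\<mu>\<^sub>t - \<mu>\<^sup>*, x\<^sub>t\<rangle>\<close> contributes at most \<open>(\<kappa> / 8) \<Sum> q\<^sub>t\<^sup>2\<close>.
  Strong convexity at \<open>\<mu>\<^sup>*\<close> bounds \<open>(\<kappa> / 2) \<Sum> q\<^sub>t\<^sup>2\<close> by the regret plus the martingale \<open>\<Sum> \<epsilon>\<^sub>t q\<^sub>t\<close>, which
  is at most \<open>(\<kappa> / 4) \<Sum> q\<^sub>t\<^sup>2 + 2 R\<^sup>2 log(1/\<delta>) / \<kappa>\<close> with high probability; hence half of the regret is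
  absorbed. What remains is \<open>\<Sum> \<epsilon>\<^sub>t\<^sup>2 w\<^sub>t\<close>, which concentrates around at most \<open>\<sigma>\<^sup>2 \<Sum> w\<^sub>t\<close>, and \<open>\<Sum> w\<^sub>t\<close> is
  logarithmic in \<open>T\<close> because \<open>- log (1 - w\<^sub>t)\<close> is the increment of the log-determinant of the Gram matrix.
\<close>

subsection \<open>Determinants of positive definite matrices\<close>

text \<open>Cramer's rule for the identity matrix. Both determinants computed below, of an
  elimination matrix and of a rotated rank-one update, are brought to this shape.\<close>

lemma det_mat_1_replace_column:
  fixes a :: "real ^ 'n"
  shows "det (\<chi> i j. if j = k then a $ i else mat 1 $ i $ j) = a $ k"
  using cramer_lemma[where A = "mat 1 :: real ^ 'n ^ 'n" and x = a and k = k]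
  unfolding matrix_vector_mul_lid by simp

lemma inner_symmetric_matrix:
  fixes V :: "real ^ 'n ^ 'n"
  assumes "transpose V = V"
  shows "u \<bullet> (V *v w) = (V *v u) \<bullet> w"
  using assms by (metis dot_lmul_matrix vector_transpose_matrix)

text \<open>Symmetric elimination clears row and column \<open>k\<close>: it preserves determinant and definiteness,
  and only decreases the diagonal. The induction is over the rows still to be cleared.\<close>

lemma pos_def_det_bounds_aux:
  fixes V :: "real ^ 'n ^ 'n"
  assumes "finite S"
    and "transpose V = V" and "\<And>u. u \<noteq> 0 \<Longrightarrow> 0 < u \<bullet> (V *v u)"
    and "\<And>i j. i \<notin> S \<Longrightarrow> i \<noteq> j \<Longrightarrow> V $ i $ j = 0"
  shows "0 < det V \<and> det V \<le> (\<Prod>i\<in>UNIV. V $ i $ i)"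
  using assms
proof (induction S arbitrary: V rule: finite_induct)
  case empty
  have "0 < V $ i $ i" for i
    using empty(2)[of "axis i 1"]
    by (simp add: inner_axis' matrix_vector_mul_component inner_axis axis_eq_0_iff)
  moreover have "det V = (\<Prod>i\<in>UNIV. V $ i $ i)"
    using empty(3) by (intro det_diagonal) auto
  ultimately show ?case by (simp add: prod_pos)
next
  case (insert k S)
  have pos: "0 < V $ i $ i" for i
    using insert.prems(2)[of "axis i 1"]
    by (simp add: inner_axis' matrix_vector_mul_component inner_axis axis_eq_0_iff)
  have sym: "V $ i $ j = V $ j $ i" for i j
    using insert.prems(1) by (metis transpose_def vec_lambda_beta)
  \<comment> \<open>Column \<open>k\<close> of an elementary matrix: multiplying by \<open>E\<close>
    on the left subtracts from every other row of \<open>V\<close> the multiple of row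
    \<open>k\<close> that clears column \<open>k\<close>; multiplying by its transpose on the right
    does the same to the columns.\<close>
  define a :: "real ^ 'n" where "a = (\<chi> i. if i = k then 1 else - (V $ i $ k / V $ k $ k))"
  define E :: "real ^ 'n ^ 'n" where "E = (\<chi> i j. if j = k then a $ i else mat 1 $ i $ j)"
  define W where "W = E ** V ** transpose E"
  have detE: "det E = 1"
    unfolding E_def by (subst det_mat_1_replace_column) (simp add: a_def)
  have EM: "(E ** N) $ i $ j = (if i = k then 0 else N $ i $ j) + a $ i * N $ k $ j"
    for N :: "real ^ 'n ^ 'n" and i j
  proof -
    have "(E ** N) $ i $ j = (\<Sum>l\<in>UNIV. E $ i $ l * N $ l $ j)"
      by (simp add: matrix_matrix_mult_def)
    also have "\<dots> = (\<Sum>l\<in>UNIV. (if l = k then a $ i * N $ k $ j else 0)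
      + (if l = i then (if i = k then 0 else N $ i $ j) else 0))"
      by (rule sum.cong) (auto simp: E_def mat_def)
    finally show ?thesis by (simp add: sum.distrib)
  qed
  \<comment> \<open>Written with two transposes, the column operation is another row operation, so
    that \<open>EM\<close> applies a second time.\<close>
  have W1: "W = transpose (E ** transpose (E ** V))"
    unfolding W_def by (simp add: matrix_transpose_mul)
  have W: "W $ i $ j = (if j = k then 0 else (E ** V) $ i $ j) + a $ j * (E ** V) $ i $ k" for i j
  proof -
    have "W $ i $ j = (E ** transpose (E ** V)) $ j $ i"
      unfolding W1 by (simp add: transpose_def)
    also have "\<dots> = (if j = k then 0 else (E ** V) $ i $ j) + a $ j * (E ** V) $ i $ k"
      unfolding EM[of "transpose (E ** V)"] by (simp add: transpose_def)
    finally show ?thesis .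
  qed
  have Went: "W $ i $ j = (if i = k \<and> j = k then V $ k $ k else if i = k \<or> j = k then 0
     else V $ i $ j - V $ i $ k * V $ k $ j / V $ k $ k)" for i j
    unfolding W EM using pos[of k] sym[of k j] by (auto simp: a_def field_simps)
  have "0 < det W \<and> det W \<le> (\<Prod>i\<in>UNIV. W $ i $ i)"
  proof (rule insert.IH)
    show "transpose W = W"
      unfolding W_def using insert.prems(1) by (simp add: matrix_transpose_mul matrix_mul_assoc)
    show "0 < u \<bullet> (W *v u)" if "u \<noteq> 0" for u
    proof -
      have "invertible (transpose E)"
        using detE by (simp add: invertible_det_nz)
      then have "transpose E *v u \<noteq> 0"
        using that by (metis invertible_def matrix_vector_mul_assoc matrix_vector_mul_lid matrix_vector_mult_0_right)
      then have "0 < (transpose E *v u) \<bullet> (V *v (transpose E *v u))"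
        by (rule insert.prems(2))
      also have "\<dots> = u \<bullet> (W *v u)"
        unfolding W_def by (simp add: matrix_vector_mul_assoc[symmetric])
          (metis dot_lmul_matrix vector_transpose_matrix transpose_transpose)
      finally show ?thesis .
    qed
    \<comment> \<open>Rows cleared earlier stay clear: their entry in column \<open>k\<close> is
      zero, so nothing is subtracted from them. Row \<open>k\<close> is cleared by the present
      elimination.\<close>
    show "W $ i $ j = 0" if "i \<notin> S" "i \<noteq> j" for i j
      using that insert.prems(3)[of i j] insert.prems(3)[of i k]
      by (cases "i = k") (auto simp: Went)
  qed
  moreover have "det W = det V"
    unfolding W_def by (simp add: det_mul detE)
  moreover have "(\<Prod>i\<in>UNIV. W $ i $ i) \<le> (\<Prod>i\<in>UNIV. V $ i $ i)"
  proof (rule prod_mono, intro conjI)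
    fix i
    show "W $ i $ i \<le> V $ i $ i"
      unfolding Went using pos[of k] sym[of k i] by auto
    have "0 < axis i 1 \<bullet> (W *v axis i 1)"
    proof -
      have "invertible (transpose E)"
        using detE by (simp add: invertible_det_nz)
      then have "transpose E *v axis i 1 \<noteq> 0"
        by (metis axis_eq_0_iff invertible_def matrix_vector_mul_assoc matrix_vector_mul_lid matrix_vector_mult_0_right zero_neq_one)
      then have "0 < (transpose E *v axis i 1) \<bullet> (V *v (transpose E *v axis i 1))"
        by (rule insert.prems(2))
      also have "\<dots> = axis i 1 \<bullet> (W *v axis i 1)"
        unfolding W_def by (simp add: matrix_vector_mul_assoc[symmetric])
          (metis dot_lmul_matrix vector_transpose_matrix transpose_transpose)
      finally show ?thesis .
    qed
    then show "0 \<le> W $ i $ i"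
      by (simp add: inner_axis' matrix_vector_mul_component inner_axis)
  qed
  ultimately show ?case by simp
qed

lemma
  fixes V :: "real ^ 'n ^ 'n"
  assumes "transpose V = V" and "\<And>u. u \<noteq> 0 \<Longrightarrow> 0 < u \<bullet> (V *v u)"
  shows pos_def_det_pos: "0 < det V"
    and hadamard_pos_def: "det V \<le> (\<Prod>i\<in>UNIV. V $ i $ i)"
  using pos_def_det_bounds_aux[of UNIV V] assms by auto

section \<open>Determinants under rank-one updates\<close>

definition outer :: "real ^ 'n \<Rightarrow> real ^ 'n \<Rightarrow> real ^ 'n ^ 'n" where
  "outer u v = (\<chi> i j. u $ i * v $ j)"

lemma outer_mult_vec: "outer u v *v w = (v \<bullet> w) *\<^sub>R u"
  by (simp add: vec_eq_iff outer_def matrix_vector_mult_def inner_vec_def sum_distrib_left mult_ac)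

text \<open>An orthogonal map takes \<open>v\<close> to a multiple of a coordinate axis. Conjugation
  by it preserves the determinant, and the conjugated matrix differs from the identity in column
  \<open>k\<close> only.\<close>

lemma det_mat_1_minus_outer:
  fixes u v :: "real ^ 'n"
  shows "det (mat 1 - outer u v) = 1 - v \<bullet> u"
proof -
  \<comment> \<open>An arbitrary coordinate.\<close>
  define k :: 'n where "k = undefined"
  obtain f :: "real ^ 'n \<Rightarrow> real ^ 'n" where f: "orthogonal_transformation f" "f v = norm v *\<^sub>R axis k 1"
    by (rule orthogonal_transformation_exists[of v "norm v *\<^sub>R axis k 1"]) auto
  define Q where "Q = matrix f"
  have lin: "linear f" using f(1) by (simp add: orthogonal_transformation_linear)
  have Qf: "Q *v w = f w" for w
    unfolding Q_def using lin by simp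
  have QQ: "Q ** transpose Q = mat 1"
    using f(1) unfolding Q_def orthogonal_transformation_matrix orthogonal_matrix_def by auto
  define a where "a = axis k 1 - norm v *\<^sub>R f u"
  have ff: "f x \<bullet> f y = x \<bullet> y" for x y
    using f(1) by (simp add: orthogonal_transformation_def)
  have "Q ** (mat 1 - outer u v) ** transpose Q = (\<chi> i j. if j = k then a $ i else mat 1 $ i $ j)"
    (is "?L = ?R")
  proof (subst matrix_eq, rule allI)
    fix w
    have "v \<bullet> (transpose Q *v w) = f v \<bullet> w"
      by (metis Qf dot_lmul_matrix vector_transpose_matrix transpose_transpose)
    also have "\<dots> = norm v * w $ k" by (simp add: f(2) inner_axis')
    finally have vw: "v \<bullet> (transpose Q *v w) = norm v * w $ k" .
    have "?L *v w = Q *v (transpose Q *v w - (v \<bullet> (transpose Q *v w)) *\<^sub>R u)"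
      by (simp add: matrix_vector_mul_assoc[symmetric] matrix_vector_mult_diff_rdistrib outer_mult_vec)
    also have "\<dots> = w - (norm v * w $ k) *\<^sub>R f u"
      unfolding vw matrix_vector_mult_diff_distrib matrix_vector_mul_assoc QQ
        matrix_vector_mult_scaleR Qf matrix_vector_mul_lid ..
    also have "\<dots> = ?R *v w"
    proof -
      have "(?R *v w) $ i = (\<Sum>j\<in>UNIV. ?R $ i $ j * w $ j)" for i
        by (simp add: matrix_vector_mult_def)
      also have "\<dots> i = (\<Sum>j\<in>UNIV. (if j = k then a $ i * w $ k else 0) +
         (if j = i then (if i = k then 0 else w $ i) else 0))" for i
        by (rule sum.cong) (auto simp: mat_def)
      finally have "(?R *v w) $ i = (if i = k then 0 else w $ i) + a $ i * w $ k" for i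
        by (simp add: sum.distrib)
      then show ?thesis
        by (auto simp: vec_eq_iff a_def axis_def algebra_simps)
    qed
    finally show "?L *v w = ?R *v w" .
  qed
  then have "det (Q ** (mat 1 - outer u v) ** transpose Q) = a $ k"
    by (simp add: det_mat_1_replace_column)
  moreover have "det (Q ** (mat 1 - outer u v) ** transpose Q) = det (mat 1 - outer u v) * det (Q ** transpose Q)"
    by (simp add: det_mul)
  moreover have "a $ k = 1 - v \<bullet> u"
  proof -
    have "v \<bullet> u = f v \<bullet> f u" by (simp add: ff)
    then show ?thesis by (simp add: a_def f(2) inner_axis')
  qed
  ultimately show ?thesis by (simp add: QQ)
qed

text \<open>The matrix determinant lemma with a solution \<open>z\<close> of the linear system in
  place of the inverse: \<open>outer u v\<close> is \<open>V ** outer z v\<close>, so that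
  \<open>V\<close> factors out.\<close>

lemma det_minus_outer:
  fixes V :: "real ^ 'n ^ 'n"
  assumes "V *v z = u"
  shows "det (V - outer u v) = det V * (1 - v \<bullet> z)"
proof -
  have "V - outer u v = V ** (mat 1 - outer z v)"
  proof (subst matrix_eq, rule allI)
    fix w
    show "(V - outer u v) *v w = (V ** (mat 1 - outer z v)) *v w"
      by (simp add: matrix_vector_mul_assoc[symmetric] matrix_vector_mult_diff_rdistrib
          outer_mult_vec matrix_vector_mult_diff_distrib matrix_vector_mult_scaleR assms)
  qed
  then show ?thesis by (simp add: det_mul det_mat_1_minus_outer)
qed

subsection \<open>Leverage scores and the elliptical potential\<close>

definition reg_gram :: "real \<Rightarrow> (nat \<Rightarrow> real ^ 'n) \<Rightarrow> nat \<Rightarrow> real ^ 'n ^ 'n" where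
  "reg_gram c x t = mat c + (\<Sum>\<tau>=1..t. outer (x \<tau>) (x \<tau>))"

text \<open>By the matrix determinant lemma this is \<open>x\<^sub>t \<bullet> V\<^sub>t\<^sup>-\<^sup>1 x\<^sub>t\<close>
  for \<open>V\<^sub>t = reg_gram c x t\<close>; the ratio of determinants is evidently measurable in the features.\<close>

definition leverage :: "real \<Rightarrow> (nat \<Rightarrow> real ^ 'n) \<Rightarrow> nat \<Rightarrow> real" where
  "leverage c x t = 1 - det (reg_gram c x (t - 1)) / det (reg_gram c x t)"

lemma reg_gram_Suc: "reg_gram c x (Suc t) = reg_gram c x t + outer (x (Suc t)) (x (Suc t))"
  by (simp add: reg_gram_def add.assoc)

lemma reg_gram_component:
  "reg_gram c x t $ i $ j = (if i = j then c else 0) + (\<Sum>\<tau>=1..t. x \<tau> $ i * x \<tau> $ j)"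
  by (simp add: reg_gram_def mat_def outer_def)

lemma reg_gram_mult_vec: "reg_gram c x t *v u = c *\<^sub>R u + (\<Sum>\<tau>=1..t. (x \<tau> \<bullet> u) *\<^sub>R x \<tau>)"
proof (induction t)
  case 0
  show ?case
    by (simp add: reg_gram_def vec_eq_iff matrix_vector_mult_def mat_def if_distribR if_distrib cong: if_cong)
next
  case (Suc t)
  then show ?case
    by (simp add: reg_gram_Suc matrix_vector_mult_add_rdistrib outer_mult_vec add.assoc)
qed

lemma quadratic_form_reg_gram:
  "u \<bullet> (reg_gram c x t *v u) = c * (norm u)\<^sup>2 + (\<Sum>\<tau>=1..t. (x \<tau> \<bullet> u)\<^sup>2)"
  by (simp add: reg_gram_mult_vec inner_add_right inner_sum_right dot_square_norm
      power2_eq_square[of "inner _ _"] inner_commute)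

lemma transpose_reg_gram: "transpose (reg_gram c x t) = reg_gram c x t"
  by (simp add: vec_eq_iff transpose_def reg_gram_component mult.commute)

lemma reg_gram_pos_def:
  assumes "0 < c" "u \<noteq> 0"
  shows "0 < u \<bullet> (reg_gram c x t *v u)"
  unfolding quadratic_form_reg_gram using assms by (intro add_pos_nonneg sum_nonneg) auto

lemma det_reg_gram_pos: "0 < c \<Longrightarrow> 0 < det (reg_gram c x t)"
  by (rule pos_def_det_pos[OF transpose_reg_gram reg_gram_pos_def])

text \<open>The Gram matrix of the preceding round is that of round \<open>t\<close> with one outer
  product removed, so \<open>det_minus_outer\<close> evaluates the ratio of determinants. The
  witness \<open>z\<close> stands for the inverse Gram matrix applied to \<open>x t\<close>.\<close>

lemma leverage_obtain:
  assumes "0 < c" "1 \<le> t"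
  obtains z where "reg_gram c x t *v z = x t" "leverage c x t = x t \<bullet> z"
proof -
  have "invertible (reg_gram c x t)"
    using det_reg_gram_pos[OF assms(1), of x t] by (simp add: invertible_det_nz)
  then obtain z where z: "reg_gram c x t *v z = x t"
    by (metis invertible_def matrix_vector_mul_assoc matrix_vector_mul_lid)
  have "reg_gram c x (t - 1) = reg_gram c x t - outer (x t) (x t)"
    using assms(2) reg_gram_Suc[of c x "t - 1"] by simp
  then have "det (reg_gram c x (t - 1)) = det (reg_gram c x t) * (1 - x t \<bullet> z)"
    using det_minus_outer[OF z] by simp
  then have "leverage c x t = x t \<bullet> z"
    using det_reg_gram_pos[OF assms(1), of x t] by (simp add: leverage_def)
  with z that show thesis by blast
qed

text \<open>For the witness \<open>z\<close>, the quadratic form of the Gram matrix at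
  \<open>z\<close> is the leverage itself and is at least c |z|^2. Cauchy-Schwarz turns this into
  |z| <= |x_t| / c, and a second use of it gives the upper bound.\<close>

lemma
  assumes "0 < c" "1 \<le> t"
  shows leverage_nonneg: "0 \<le> leverage c x t"
    and leverage_le: "norm (x t) \<le> A \<Longrightarrow> leverage c x t \<le> A\<^sup>2 / c"
proof -
  obtain z where z: "reg_gram c x t *v z = x t" "leverage c x t = x t \<bullet> z"
    using leverage_obtain[OF assms] .
  have *: "c * (norm z)\<^sup>2 \<le> x t \<bullet> z"
    using quadratic_form_reg_gram[of z c x t] sum_nonneg[of "{1..t}" "\<lambda>\<tau>. (x \<tau> \<bullet> z)\<^sup>2"]
    by (simp add: z inner_commute)
  have "0 \<le> c * (norm z)\<^sup>2" using assms(1) by simp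
  with * show "0 \<le> leverage c x t" unfolding z by linarith
  assume A: "norm (x t) \<le> A"
  have xz: "x t \<bullet> z \<le> norm (x t) * norm z" by (rule norm_cauchy_schwarz)
  then have "c * norm z * norm z \<le> norm (x t) * norm z"
    using * by (simp add: power2_eq_square mult.assoc)
  then have "c * norm z \<le> norm (x t)"
    by (cases "norm z = 0") (auto dest: mult_right_le_imp_le)
  then have "norm z \<le> A / c"
    using A assms(1) by (simp add: field_simps)
  then have "norm (x t) * norm z \<le> A * (A / c)"
    using A by (intro mult_mono) (auto intro: order_trans[OF norm_ge_zero])
  with xz show "leverage c x t \<le> A\<^sup>2 / c"
    unfolding z by (simp add: power2_eq_square)
qed

text \<open>The quadratic function of \<open>v\<close> is smallest at
  \<open>v = - (\<beta> / \<kappa>) z\<close>, where the leverage term compensates it exactly. In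
  the regret analysis \<open>v\<close> is the move of the iterate and \<open>\<beta>\<close> the
  residual of the current round.\<close>

lemma leverage_completes_square:
  fixes x :: "nat \<Rightarrow> real ^ 'n"
  assumes "0 < c" "1 \<le> t" "0 < \<kappa>"
  shows "0 \<le> \<kappa> / 2 * (c * (norm v)\<^sup>2 + (\<Sum>\<tau>=1..t. (x \<tau> \<bullet> v)\<^sup>2)) + \<beta> * (x t \<bullet> v)
    + \<beta>\<^sup>2 / (2 * \<kappa>) * leverage c x t"
proof -
  obtain z where z: "reg_gram c x t *v z = x t" "leverage c x t = x t \<bullet> z"
    using leverage_obtain[OF assms(1,2)] .
  let ?V = "reg_gram c x t"
  let ?s = "\<beta> / \<kappa>"
  have zV: "z \<bullet> (?V *v v) = x t \<bullet> v"
    by (simp add: inner_symmetric_matrix[OF transpose_reg_gram] z)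
  have "0 \<le> (v + ?s *\<^sub>R z) \<bullet> (?V *v (v + ?s *\<^sub>R z))"
    using reg_gram_pos_def[OF assms(1)] by (cases "v + ?s *\<^sub>R z = 0") (auto intro: less_imp_le)
  also have "\<dots> = v \<bullet> (?V *v v) + 2 * ?s * (x t \<bullet> v) + ?s\<^sup>2 * leverage c x t"
    by (simp add: matrix_vector_right_distrib matrix_vector_mult_scaleR inner_add_left inner_add_right
        z(1) zV) (simp add: z(2) inner_commute power2_eq_square add_divide_distrib algebra_simps)
  finally have "0 \<le> \<kappa> / 2 * (v \<bullet> (?V *v v) + 2 * ?s * (x t \<bullet> v) + ?s\<^sup>2 * leverage c x t)"
    using assms(3) by simp
  also have "\<dots> = \<kappa> / 2 * (v \<bullet> (?V *v v)) + \<beta> * (x t \<bullet> v) + \<beta>\<^sup>2 / (2 * \<kappa>) * leverage c x t"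
    using assms(3) by (simp add: field_simps power2_eq_square)
  finally show ?thesis by (simp add: quadratic_form_reg_gram)
qed

lemma ln_det_reg_gram_le:
  fixes x :: "nat \<Rightarrow> real ^ 'n"
  assumes "0 < c" and "\<And>\<tau>. \<tau> \<in> {1..t} \<Longrightarrow> norm (x \<tau>) \<le> A"
  shows "ln (det (reg_gram c x t)) \<le> real CARD('n) * ln (c + real t * A\<^sup>2 / real CARD('n))"
proof -
  let ?V = "reg_gram c x t" and ?d = "real CARD('n)"
  define s where "s = c + real t * A\<^sup>2 / ?d"
  have d: "0 < ?d" by simp
  have s: "0 < s" unfolding s_def using assms(1) by (intro add_pos_nonneg) auto
  have Vpos: "0 < ?V $ i $ i" for i
    unfolding reg_gram_component using assms(1) by (simp add: add_pos_nonneg sum_nonneg)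
  have tr: "(\<Sum>i\<in>UNIV. ?V $ i $ i) \<le> ?d * s"
  proof -
    have "(\<Sum>i\<in>UNIV. ?V $ i $ i) = ?d * c + (\<Sum>\<tau>=1..t. \<Sum>i\<in>UNIV. x \<tau> $ i * x \<tau> $ i)"
      unfolding reg_gram_component by (simp add: sum.distrib) (rule sum.swap)
    also have "(\<Sum>\<tau>=1..t. \<Sum>i\<in>UNIV. x \<tau> $ i * x \<tau> $ i) = (\<Sum>\<tau>=1..t. (norm (x \<tau>))\<^sup>2)"
      by (simp add: power2_norm_eq_inner inner_vec_def)
    also have "\<dots> \<le> (\<Sum>\<tau>=1..t. A\<^sup>2)"
      using assms(2) by (intro sum_mono power_mono) auto
    also have "?d * c + (\<Sum>\<tau>=1..t. A\<^sup>2) = ?d * s"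
      using d by (simp add: s_def field_simps)
    finally show ?thesis by simp
  qed
  have "ln (det ?V) \<le> ln (\<Prod>i\<in>UNIV. ?V $ i $ i)"
    using hadamard_pos_def[OF transpose_reg_gram reg_gram_pos_def[OF assms(1)], of x t]
      det_reg_gram_pos[OF assms(1), of x t] by (intro ln_mono) (auto simp: prod_pos Vpos)
  also have "\<dots> = (\<Sum>i\<in>UNIV. ln (?V $ i $ i))"
    using Vpos by (intro ln_prod) (auto simp: less_imp_neq[symmetric])
  \<comment> \<open>The tangent of the logarithm at the upper bound \<open>s\<close> for the mean
    diagonal entry: the linear corrections add up to the trace over \<open>s\<close> minus the
    dimension, which is at most 0.\<close>
  also have "\<dots> \<le> (\<Sum>i\<in>UNIV. ln s + (?V $ i $ i / s - 1))"
  proof (rule sum_mono)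
    fix i :: 'n
    have "ln (?V $ i $ i / s) \<le> ?V $ i $ i / s - 1"
      by (rule ln_le_minus_one) (simp add: Vpos s divide_pos_pos del: divide_divide_eq_right)
    then show "ln (?V $ i $ i) \<le> ln s + (?V $ i $ i / s - 1)"
      using Vpos[of i] s by (simp add: ln_div)
  qed
  also have "\<dots> = ?d * ln s + ((\<Sum>i\<in>UNIV. ?V $ i $ i) / s - ?d)"
    by (simp add: sum.distrib sum_subtractf sum_divide_distrib)
  also have "\<dots> \<le> ?d * ln s"
    using tr s by (simp add: pos_divide_le_eq)
  finally show ?thesis by (simp add: s_def)
qed

lemma sum_leverage_le:
  fixes x :: "nat \<Rightarrow> real ^ 'n"
  assumes "0 < c" and "\<And>t. t \<in> {1..T} \<Longrightarrow> norm (x t) \<le> A"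
  shows "(\<Sum>t=1..T. leverage c x t) \<le> real CARD('n) * ln (1 + real T * A\<^sup>2 / (c * real CARD('n)))"
proof -
  let ?d = "real CARD('n)"
  have "(\<Sum>t=1..m. leverage c x t) \<le> ln (det (reg_gram c x m)) - ln (det (reg_gram c x 0))" for m
  proof (induction m)
    case (Suc m)
    have "0 < det (reg_gram c x m) / det (reg_gram c x (Suc m))"
      by (simp add: det_reg_gram_pos assms(1))
    then have "leverage c x (Suc m) \<le> - ln (det (reg_gram c x m) / det (reg_gram c x (Suc m)))"
      using ln_le_minus_one by (fastforce simp: leverage_def)
    also have "\<dots> = ln (det (reg_gram c x (Suc m))) - ln (det (reg_gram c x m))"
      using det_reg_gram_pos[OF assms(1), of x m] det_reg_gram_pos[OF assms(1), of x "Suc m"]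
      by (simp add: ln_div)
    finally show ?case using Suc by simp
  qed simp
  then have "(\<Sum>t=1..T. leverage c x t) \<le> ln (det (reg_gram c x T)) - ln (det (reg_gram c x 0))" .
  also have "det (reg_gram c x 0) = c ^ CARD('n)"
    by (subst det_diagonal) (auto simp: reg_gram_component)
  also have "ln (c ^ CARD('n)) = ?d * ln c"
    using assms(1) by (simp add: ln_realpow)
  also have "ln (det (reg_gram c x T)) - ?d * ln c \<le> ?d * ln (c + real T * A\<^sup>2 / ?d) - ?d * ln c"
    using ln_det_reg_gram_le[OF assms] by simp
  also have "\<dots> = ?d * ln ((c + real T * A\<^sup>2 / ?d) / c)"
  proof -
    have "0 < c + real T * A\<^sup>2 / ?d"
      using assms(1) by (intro add_pos_nonneg) auto
    with assms(1) show ?thesis by (simp add: ln_div algebra_simps)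
  qed
  also have "(c + real T * A\<^sup>2 / ?d) / c = 1 + real T * A\<^sup>2 / (c * ?d)"
    using assms(1) by (simp add: field_simps)
  finally show ?thesis .
qed

subsection \<open>Losses of a generalized linear model\<close>

text \<open>The interval property keeps segments between predictors inside \<open>D\<close>; 0
  belongs to \<open>D\<close> because the integral in the loss starts there.\<close>

locale interval_activation =
  fixes D :: "real set" and \<phi> \<phi>' :: "real \<Rightarrow> real" and \<kappa> K :: real
  assumes is_interval_D: "is_interval D" and zero_in_D: "0 \<in> D"
    and activation: "activation_on D \<phi> \<phi>' \<kappa> K"
begin

lemma kappa_pos: "0 < \<kappa>"
  using activation by (simp add: activation_on_def)

lemma K_pos: "0 < K"
proof -
  have "\<kappa> \<le> \<phi>' 0" "\<phi>' 0 \<le> K"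
    using activation zero_in_D by (simp_all add: activation_on_def)
  with kappa_pos show ?thesis by linarith
qed

lemma subset_D: "p \<in> D \<Longrightarrow> q \<in> D \<Longrightarrow> {p..q} \<subseteq> D"
  by (meson atLeastAtMost_iff is_interval_D mem_is_interval_1_I subsetI)

lemma continuous_on_activation: "continuous_on D \<phi>"
  by (rule DERIV_continuous_on[where D = \<phi>']) (use activation in \<open>simp add: activation_on_def\<close>)

lemma activation_increment:
  assumes "p \<in> D" "q \<in> D" "p \<le> q"
  shows "\<kappa> * (q - p) \<le> \<phi> q - \<phi> p" and "\<phi> q - \<phi> p \<le> K * (q - p)"
proof -
  have "\<kappa> * (q - p) \<le> \<phi> q - \<phi> p \<and> \<phi> q - \<phi> p \<le> K * (q - p)"
  proof (cases "p = q")
    case False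
    then have "p < q" using assms by simp
    moreover have "(\<phi> has_derivative (*) (\<phi>' z)) (at z within {p..q})" if "p \<le> z" "z \<le> q" for z
    proof -
      have "z \<in> D" using subset_D[OF assms(1,2)] that by auto
      then have "(\<phi> has_derivative (*) (\<phi>' z)) (at z within D)"
        using activation by (simp add: activation_on_def has_field_derivative_def)
      then show ?thesis
        using subset_D[OF assms(1,2)] by (rule has_derivative_subset)
    qed
    ultimately obtain z where z: "z \<in> {p<..<q}" "\<phi> q - \<phi> p = \<phi>' z * (q - p)"
      using mvt_simple[of p q \<phi> "\<lambda>z. (*) (\<phi>' z)"] by blast
    then have "z \<in> D" using subset_D[OF assms(1,2)] by auto
    then show ?thesis
      using z \<open>p < q\<close> activation by (simp add: activation_on_def mult_right_mono)
  qed simp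
  then show "\<kappa> * (q - p) \<le> \<phi> q - \<phi> p" "\<phi> q - \<phi> p \<le> K * (q - p)" by auto
qed

lemma activation_lipschitz:
  assumes "p \<in> D" "q \<in> D"
  shows "(\<phi> q - \<phi> p)\<^sup>2 \<le> K\<^sup>2 * (q - p)\<^sup>2"
proof -
  have "\<bar>\<phi> q - \<phi> p\<bar> \<le> \<bar>K * (q - p)\<bar>"
  proof (cases "p \<le> q")
    case True
    then have "0 \<le> \<kappa> * (q - p)" using kappa_pos by simp
    with activation_increment[OF assms True] show ?thesis by linarith
  next
    case False
    then have "0 \<le> \<kappa> * (p - q)" "q \<le> p" using kappa_pos by simp_all
    with activation_increment[OF assms(2,1)] show ?thesis by (simp add: algebra_simps)
  qed
  then show ?thesis by (simp add: abs_le_square_iff power_mult_distrib)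
qed

section \<open>The primitive of the activation\<close>

definition primitive :: "real \<Rightarrow> real" where
  "primitive u = (LBINT z=0..u. \<phi> z)"

lemma primitive_has_derivative:
  assumes "p \<in> D" "q \<in> D" "z \<in> {p..q}"
  shows "(primitive has_real_derivative \<phi> z) (at z within {p..q})"
proof -
  \<comment> \<open>The fundamental theorem is applied on an interval that also contains 0, the base
    point of the integral, and the derivative is then restricted to \<open>{p..q}\<close>.\<close>
  let ?a = "min 0 p" and ?b = "max 0 q"
  have "{?a..?b} \<subseteq> D"
    using assms zero_in_D by (intro subset_D) (auto simp: min_def max_def)
  then have "continuous_on {?a..?b} \<phi>"
    by (rule continuous_on_subset[OF continuous_on_activation])
  then have "((\<lambda>u. LBINT z=ereal 0..u. \<phi> z) has_vector_derivative \<phi> z) (at z within {?a..?b})"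
    using assms by (intro interval_integral_FTC2) auto
  then have "(primitive has_real_derivative \<phi> z) (at z within {?a..?b})"
    unfolding primitive_def[abs_def] has_real_derivative_iff_has_vector_derivative
    by (simp add: zero_ereal_def)
  then show ?thesis
    by (rule DERIV_subset) (intro atLeastatMost_subset_iff[THEN iffD2] disjI2 conjI min.cobounded2 max.cobounded2)
qed

text \<open>\<open>G\<close> is the primitive minus the linear and quadratic terms at
  \<open>p\<close>. Since \<open>\<phi>\<close> grows at rate at least \<open>\<kappa>\<close>, the
  derivative \<open>G'\<close> is nonnegative to the right of \<open>p\<close> and nonpositive to
  the left, so \<open>G\<close> is smallest at \<open>p\<close>.\<close>

lemma primitive_above_tangent:
  assumes "p \<in> D" "q \<in> D"
  shows "primitive p + \<phi> p * (q - p) + \<kappa> / 2 * (q - p)\<^sup>2 \<le> primitive q"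
proof -
  define G where "G z = primitive z - \<phi> p * (z - p) - \<kappa> / 2 * (z - p)\<^sup>2" for z
  define G' where "G' z = \<phi> z - \<phi> p - \<kappa> * (z - p)" for z
  have G: "(G has_derivative (*) (G' z)) (at z within {a..b})" if "a \<in> D" "b \<in> D" "z \<in> {a..b}" for a b z
    unfolding G_def[abs_def] G'_def has_field_derivative_def[symmetric]
    by (rule primitive_has_derivative[OF that] derivative_eq_intros refl | simp)+
  consider "p < q" | "p = q" | "q < p" by linarith
  then have "G p \<le> G q"
  proof cases
    case 1
    then obtain z where z: "z \<in> {p<..<q}" "G q - G p = G' z * (q - p)"
      using mvt_simple[of p q G "\<lambda>z. (*) (G' z)"] G[OF assms] by auto
    moreover have "0 \<le> G' z"
    proof -
      have "z \<in> D" using z(1) subset_D[OF assms] by auto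
      with activation_increment(1)[OF assms(1), of z] z(1) show ?thesis by (simp add: G'_def)
    qed
    ultimately have "0 \<le> G q - G p" using 1 by simp
    then show ?thesis by simp
  next
    case 3
    then obtain z where z: "z \<in> {q<..<p}" "G p - G q = G' z * (p - q)"
      using mvt_simple[of q p G "\<lambda>z. (*) (G' z)"] G[OF assms(2,1)] by auto
    moreover have "G' z \<le> 0"
    proof -
      have "z \<in> D" using z(1) subset_D[OF assms(2,1)] by auto
      with activation_increment(1)[OF _ assms(1), of z] z(1)
      show ?thesis by (simp add: G'_def algebra_simps)
    qed
    ultimately have "G p - G q \<le> 0" using 3 by (simp add: mult_nonpos_nonneg)
    then show ?thesis by simp
  qed simp
  then show ?thesis by (simp add: G_def)
qed

text \<open>Used for the measurability of the regret. By convexity the tangent at \<open>p\<close>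
  bounds \<open>primitive q\<close> from below and the tangent at \<open>q\<close> bounds it from
  above; both bounds tend to \<open>primitive p\<close>.\<close>

lemma continuous_on_primitive: "continuous_on D primitive"
proof (unfold continuous_on_def, intro ballI)
  fix p assume p: "p \<in> D"
  have phi: "(\<phi> \<longlongrightarrow> \<phi> p) (at p within D)"
    using continuous_on_activation p by (simp add: continuous_on_def)
  have D: "eventually (\<lambda>q. q \<in> D) (at p within D)"
    by (simp add: eventually_at_filter)
  show "(primitive \<longlongrightarrow> primitive p) (at p within D)"
  proof (rule tendsto_sandwich)
    have "primitive p + \<phi> p * (q - p) \<le> primitive q \<and> primitive q \<le> primitive p + \<phi> q * (q - p)"
      if "q \<in> D" for q
    proof -
      have "0 \<le> \<kappa> / 2 * (q - p)\<^sup>2" "0 \<le> \<kappa> / 2 * (p - q)\<^sup>2"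
        using kappa_pos by simp_all
      with primitive_above_tangent[OF p that] primitive_above_tangent[OF that p]
      show ?thesis by (simp add: algebra_simps)
    qed
    with D show "eventually (\<lambda>q. primitive p + \<phi> p * (q - p) \<le> primitive q) (at p within D)"
      and "eventually (\<lambda>q. primitive q \<le> primitive p + \<phi> q * (q - p)) (at p within D)"
      by (auto elim: eventually_mono)
    show "((\<lambda>q. primitive p + \<phi> p * (q - p)) \<longlongrightarrow> primitive p) (at p within D)"
      by (auto intro!: tendsto_eq_intros)
    show "((\<lambda>q. primitive p + \<phi> q * (q - p)) \<longlongrightarrow> primitive p) (at p within D)"
      by (auto intro!: tendsto_eq_intros phi)
  qed
qed

lemma glm_loss_eq: "glm_loss \<phi> x y \<mu> = - (x \<bullet> \<mu>) * y + primitive (x \<bullet> \<mu>)"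
  by (simp add: glm_loss_def primitive_def)

lemma glm_loss_above_tangent:
  assumes "x \<bullet> u \<in> D" "x \<bullet> v \<in> D"
  shows "glm_loss \<phi> x y u + (\<phi> (x \<bullet> u) - y) * (x \<bullet> (v - u)) + \<kappa> / 2 * (x \<bullet> (v - u))\<^sup>2
    \<le> glm_loss \<phi> x y v"
  using primitive_above_tangent[OF assms] by (simp add: glm_loss_eq inner_diff_right algebra_simps)

text \<open>The tangent inequality at the intermediate point \<open>?m\<close>, evaluated at
  \<open>u\<close> and at \<open>v\<close> and averaged with weights 1 - s and s: the first-order
  terms cancel, and the quadratic terms combine to s (1 - s).\<close>

lemma glm_loss_strongly_convex:
  assumes "x \<bullet> u \<in> D" "x \<bullet> v \<in> D" "0 < s" "s < 1"
  shows "glm_loss \<phi> x y (u + s *\<^sub>R (v - u))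
    \<le> (1 - s) * glm_loss \<phi> x y u + s * glm_loss \<phi> x y v - s * (1 - s) * (\<kappa> / 2 * (x \<bullet> (v - u))\<^sup>2)"
proof -
  let ?m = "u + s *\<^sub>R (v - u)"
  define w where "w = x \<bullet> (v - u)"
  define g where "g = \<phi> (x \<bullet> ?m) - y"
  have "x \<bullet> ?m = (1 - s) * (x \<bullet> u) + s * (x \<bullet> v)"
    by (simp add: inner_add_right inner_diff_right algebra_simps)
  moreover have "convex D"
    using is_interval_D by (rule is_interval_convex)
  ultimately have m: "x \<bullet> ?m \<in> D"
    using assms convexD[of D "x \<bullet> u" "x \<bullet> v" "1 - s" s] by simp
  have um: "u - ?m = (- s) *\<^sub>R (v - u)" and vm: "v - ?m = (1 - s) *\<^sub>R (v - u)"
    by (simp_all add: algebra_simps)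
  have sq: "\<kappa> / 2 * (a * b)\<^sup>2 = a\<^sup>2 * (\<kappa> / 2 * b\<^sup>2)" for a b
    by (simp add: power_mult_distrib)
  have 1: "glm_loss \<phi> x y ?m - s * (g * w) + s\<^sup>2 * (\<kappa> / 2 * w\<^sup>2) \<le> glm_loss \<phi> x y u"
    using glm_loss_above_tangent[OF m assms(1), of y]
    unfolding um inner_scaleR_right sq g_def[symmetric] w_def[symmetric] by (simp add: mult_ac)
  have 2: "glm_loss \<phi> x y ?m + (1 - s) * (g * w) + (1 - s)\<^sup>2 * (\<kappa> / 2 * w\<^sup>2) \<le> glm_loss \<phi> x y v"
    using glm_loss_above_tangent[OF m assms(2), of y]
    unfolding vm inner_scaleR_right sq g_def[symmetric] w_def[symmetric] by (simp add: mult_ac)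
  have weights: "(1 - s) * (l - s * h + s\<^sup>2 * q) + s * (l + (1 - s) * h + (1 - s)\<^sup>2 * q)
     = l + s * (1 - s) * q" for l h q :: real
    by algebra
  have "(1 - s) * (glm_loss \<phi> x y ?m - s * (g * w) + s\<^sup>2 * (\<kappa> / 2 * w\<^sup>2))
      + s * (glm_loss \<phi> x y ?m + (1 - s) * (g * w) + (1 - s)\<^sup>2 * (\<kappa> / 2 * w\<^sup>2))
    \<le> (1 - s) * glm_loss \<phi> x y u + s * glm_loss \<phi> x y v"
    using assms(3,4) by (intro add_mono mult_left_mono 1 2) auto
  then show ?thesis
    unfolding weights w_def[symmetric] le_diff_eq .
qed

text \<open>The predictors of a minimiser may lie on the boundary of \<open>D\<close>, where the loss need not be
  differentiable, so the growth away from it is derived from convexity along segments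
  instead of a vanishing gradient.\<close>

lemma regularized_argmin_growth:
  fixes x :: "'i \<Rightarrow> real ^ 'n" and y :: "'i \<Rightarrow> real" and I :: "'i set" and lam :: real
  defines "L \<equiv> \<lambda>\<mu>. lam * (norm \<mu>)\<^sup>2 + (\<Sum>\<tau>\<in>I. glm_loss \<phi> (x \<tau>) (y \<tau>) \<mu>)"
  assumes min: "is_arg_min L (\<lambda>_. True) u"
    and D: "\<And>\<tau>. \<tau> \<in> I \<Longrightarrow> x \<tau> \<bullet> u \<in> D" "\<And>\<tau>. \<tau> \<in> I \<Longrightarrow> x \<tau> \<bullet> v \<in> D"
  shows "L u + lam * (norm (v - u))\<^sup>2 + \<kappa> / 2 * (\<Sum>\<tau>\<in>I. (x \<tau> \<bullet> (v - u))\<^sup>2) \<le> L v"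
proof -
  let ?Q = "lam * (norm (v - u))\<^sup>2 + \<kappa> / 2 * (\<Sum>\<tau>\<in>I. (x \<tau> \<bullet> (v - u))\<^sup>2)"
  have "?Q \<le> L v - L u"
  \<comment> \<open>Comparing \<open>u\<close> with the point at fraction \<open>s\<close> of the
    segment and dividing by \<open>s\<close> leaves the factor r = 1 - s in front of
    \<open>?Q\<close>. As this holds for every r < 1, the full growth follows.\<close>
  proof (rule field_le_mult_one_interval)
    fix r :: real assume r: "0 < r" "r < 1"
    define s where "s = 1 - r"
    have s: "0 < s" "s < 1" using r by (auto simp: s_def)
    let ?m = "u + s *\<^sub>R (v - u)"
    have "(norm ?m)\<^sup>2 = (1 - s) * (norm u)\<^sup>2 + s * (norm v)\<^sup>2 - s * (1 - s) * (norm (v - u))\<^sup>2"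
      unfolding power2_norm_eq_inner inner_add_left inner_add_right inner_diff_left inner_diff_right
        inner_scaleR_left inner_scaleR_right inner_commute[of v u] by algebra
    then have 1: "lam * (norm ?m)\<^sup>2
      = lam * ((1 - s) * (norm u)\<^sup>2 + s * (norm v)\<^sup>2 - s * (1 - s) * (norm (v - u))\<^sup>2)"
      by (rule arg_cong)
    have "(\<Sum>\<tau>\<in>I. glm_loss \<phi> (x \<tau>) (y \<tau>) ?m) \<le> (\<Sum>\<tau>\<in>I. (1 - s) * glm_loss \<phi> (x \<tau>) (y \<tau>) u
       + s * glm_loss \<phi> (x \<tau>) (y \<tau>) v - s * (1 - s) * (\<kappa> / 2 * (x \<tau> \<bullet> (v - u))\<^sup>2))"
      using s D by (intro sum_mono glm_loss_strongly_convex) auto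
    also have "\<dots> = (1 - s) * (\<Sum>\<tau>\<in>I. glm_loss \<phi> (x \<tau>) (y \<tau>) u)
       + s * (\<Sum>\<tau>\<in>I. glm_loss \<phi> (x \<tau>) (y \<tau>) v)
       - s * (1 - s) * (\<kappa> / 2 * (\<Sum>\<tau>\<in>I. (x \<tau> \<bullet> (v - u))\<^sup>2))"
      unfolding sum.distrib sum_subtractf sum_distrib_left ..
    finally have "L ?m \<le> lam * ((1 - s) * (norm u)\<^sup>2 + s * (norm v)\<^sup>2 - s * (1 - s) * (norm (v - u))\<^sup>2)
       + ((1 - s) * (\<Sum>\<tau>\<in>I. glm_loss \<phi> (x \<tau>) (y \<tau>) u)
       + s * (\<Sum>\<tau>\<in>I. glm_loss \<phi> (x \<tau>) (y \<tau>) v)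
       - s * (1 - s) * (\<kappa> / 2 * (\<Sum>\<tau>\<in>I. (x \<tau> \<bullet> (v - u))\<^sup>2)))"
      unfolding L_def 1 by (rule add_left_mono)
    also have "\<dots> = (1 - s) * L u + s * L v - s * (1 - s) * ?Q"
      unfolding L_def by algebra
    finally have "L ?m \<le> (1 - s) * L u + s * L v - s * ((1 - s) * ?Q)"
      unfolding mult.assoc .
    moreover have "L u \<le> L ?m"
      using min by (auto simp: is_arg_min_def not_less)
    moreover have "(1 - s) * L u = L u - s * L u"
      by algebra
    ultimately have "s * ((1 - s) * ?Q) \<le> s * (L v - L u)"
      unfolding right_diff_distrib[of s "L v" "L u"] by linarith
    then have "(1 - s) * ?Q \<le> L v - L u"
      using s by (simp only: mult_le_cancel_left_pos)
    then show "r * ?Q \<le> L v - L u" unfolding s_def by simp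
  qed
  then show ?thesis by simp
qed

subsection \<open>Regret of the regularized leader\<close>

text \<open>The values \<open>L t (u t) - L t (u (t + 1))\<close> telescope to the regret up to
  regularization. Each is bounded by adding the growth of \<open>L (t - 1)\<close> from its
  minimiser \<open>u t\<close> to the tangent inequality of the new loss: what remains is a
  quadratic function of the move \<open>u (t + 1) - u t\<close>, which
  \<open>leverage_completes_square\<close> controls.\<close>

lemma ftrl_regret_le:
  fixes x :: "nat \<Rightarrow> real ^ 'n"
  assumes lam: "0 < lam" and ftrl: "ftrl_iterates \<phi> lam x y T m"
    and pred: "predictors_in D T x m \<mu>"
  shows "stoc_regret \<phi> x y m \<mu> T \<le> lam * (norm \<mu>)\<^sup>2
    + (\<Sum>t=1..T. (\<phi> (x t \<bullet> m t) - y t)\<^sup>2 / (2 * \<kappa>) * leverage (2 * lam / \<kappa>) x t)"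
proof -
  define L where "L t \<nu> = lam * (norm \<nu>)\<^sup>2 + (\<Sum>\<tau>=1..t. glm_loss \<phi> (x \<tau>) (y \<tau>) \<nu>)" for t \<nu>
  text \<open>The comparator plays the part of the iterate of round \<open>T + 1\<close>.\<close>
  define u where "u t = (if t \<le> T then m t else \<mu>)" for t
  let ?lev = "leverage (2 * lam / \<kappa>) x"
  have uD: "x \<tau> \<bullet> u t \<in> D" if "1 \<le> \<tau>" "\<tau> \<le> t" "\<tau> \<le> T" for \<tau> t
    using pred that by (auto simp: predictors_in_def u_def inner_commute)
  have LSuc: "L t \<nu> = L (t - 1) \<nu> + glm_loss \<phi> (x t) (y t) \<nu>" if "1 \<le> t" for t \<nu>
    using that by (cases t) (auto simp: L_def)
  have step: "L t (u t) - L t (u (t + 1)) \<le> (\<phi> (x t \<bullet> m t) - y t)\<^sup>2 / (2 * \<kappa>) * ?lev t"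
    if t: "t \<in> {1..T}" for t
  proof -
    let ?w = "u (t + 1) - u t"
    let ?b = "\<phi> (x t \<bullet> u t) - y t"
    \<comment> \<open>In round 1 the objective is the regularizer alone, minimised by the prescribed
      start 0; later rounds use the defining property of the iterates with the index shifted by
      one.\<close>
    have "is_arg_min (L (t - 1)) (\<lambda>_. True) (u t)"
    proof (cases "t = 1")
      case True
      then show ?thesis
        using ftrl t lam by (auto simp: ftrl_iterates_def u_def L_def is_arg_min_def not_less)
    next
      case False
      then have "t - 1 \<in> {1..<T}" using t by auto
      then have "is_arg_min (L (t - 1)) (\<lambda>_. True) (m (t - 1 + 1))"
        using ftrl unfolding ftrl_iterates_def L_def by blast
      then show ?thesis using t by (simp add: u_def)
    qed
    then have 1: "L (t - 1) (u t) + lam * (norm ?w)\<^sup>2 + \<kappa> / 2 * (\<Sum>\<tau>=1..t - 1. (x \<tau> \<bullet> ?w)\<^sup>2)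
      \<le> L (t - 1) (u (t + 1))"
      unfolding L_def using t by (intro regularized_argmin_growth) (auto intro!: uD)
    have 2: "glm_loss \<phi> (x t) (y t) (u t) + ?b * (x t \<bullet> ?w) + \<kappa> / 2 * (x t \<bullet> ?w)\<^sup>2
      \<le> glm_loss \<phi> (x t) (y t) (u (t + 1))"
      using t by (intro glm_loss_above_tangent uD) auto
    have 3: "0 \<le> \<kappa> / 2 * (2 * lam / \<kappa> * (norm ?w)\<^sup>2 + (\<Sum>\<tau>=1..t. (x \<tau> \<bullet> ?w)\<^sup>2)) + ?b * (x t \<bullet> ?w)
      + ?b\<^sup>2 / (2 * \<kappa>) * ?lev t"
      using t lam kappa_pos by (intro leverage_completes_square) auto
    have sum_t: "(\<Sum>\<tau>=1..t. f \<tau>) = (\<Sum>\<tau>=1..t - 1. f \<tau>) + f t" for f :: "nat \<Rightarrow> real"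
      using t by (cases t) auto
    \<comment> \<open>The parameter \<open>2 * lam / \<kappa>\<close> is chosen so that the factor
      \<open>\<kappa> / 2\<close> returns \<open>lam\<close>: the form in \<open>3\<close> then
      consists of exactly the quadratic terms in \<open>1\<close> and \<open>2\<close>.\<close>
    have 4: "\<kappa> / 2 * (2 * lam / \<kappa> * a + (b + d)) = lam * a + \<kappa> / 2 * b + \<kappa> / 2 * d" for a b d
      using kappa_pos by (simp add: field_simps)
    have "u t = m t" using t by (simp add: u_def)
    then show ?thesis
      using 1 2 3 LSuc[of t "u t"] LSuc[of t "u (t + 1)"] t unfolding sum_t 4 by simp
  qed
  have "(\<Sum>t=1..n. L t (u t) - L t (u (t + 1)))
     = (\<Sum>t=1..n. glm_loss \<phi> (x t) (y t) (u t)) + L 0 (u 1) - L n (u (n + 1))" for n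
    by (induction n) (auto simp: LSuc)
  moreover have "(\<Sum>t=1..T. L t (u t) - L t (u (t + 1)))
    \<le> (\<Sum>t=1..T. (\<phi> (x t \<bullet> m t) - y t)\<^sup>2 / (2 * \<kappa>) * ?lev t)"
    by (rule sum_mono) (rule step)
  ultimately have "(\<Sum>t=1..T. glm_loss \<phi> (x t) (y t) (u t)) + L 0 (u 1) - L T (u (T + 1))
    \<le> (\<Sum>t=1..T. (\<phi> (x t \<bullet> m t) - y t)\<^sup>2 / (2 * \<kappa>) * ?lev t)"
    by simp
  moreover have "(\<Sum>t=1..T. glm_loss \<phi> (x t) (y t) (u t)) = (\<Sum>t=1..T. glm_loss \<phi> (x t) (y t) (m t))"
    by (rule sum.cong) (auto simp: u_def)
  moreover have "0 \<le> L 0 (u 1)" using lam by (simp add: L_def)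
  moreover have "L T (u (T + 1)) = lam * (norm \<mu>)\<^sup>2 + (\<Sum>t=1..T. glm_loss \<phi> (x t) (y t) \<mu>)"
    by (simp add: L_def u_def)
  ultimately show ?thesis by (simp add: stoc_regret_def)
qed

text \<open>At the true parameter the residual is exactly \<open>- e t\<close>, so the tangent
  inequality there has the noise as its only first-order coefficient.\<close>

lemma prediction_error_le:
  assumes pred: "predictors_in D T x m \<mu>"
    and labels: "\<And>t. t \<in> {1..T} \<Longrightarrow> y t = \<phi> (\<mu> \<bullet> x t) + e t"
  shows "\<kappa> / 2 * (\<Sum>t=1..T. (x t \<bullet> (m t - \<mu>))\<^sup>2)
    \<le> stoc_regret \<phi> x y m \<mu> T + (\<Sum>t=1..T. e t * (x t \<bullet> (m t - \<mu>)))"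
proof -
  have "(\<Sum>t=1..T. \<kappa> / 2 * (x t \<bullet> (m t - \<mu>))\<^sup>2) \<le> (\<Sum>t=1..T. glm_loss \<phi> (x t) (y t) (m t)
    - glm_loss \<phi> (x t) (y t) \<mu> + e t * (x t \<bullet> (m t - \<mu>)))"
  proof (rule sum_mono)
    fix t assume t: "t \<in> {1..T}"
    then have "x t \<bullet> \<mu> \<in> D" "x t \<bullet> m t \<in> D"
      using pred by (auto simp: predictors_in_def inner_commute)
    from glm_loss_above_tangent[OF this, of "y t"]
    show "\<kappa> / 2 * (x t \<bullet> (m t - \<mu>))\<^sup>2 \<le> glm_loss \<phi> (x t) (y t) (m t)
      - glm_loss \<phi> (x t) (y t) \<mu> + e t * (x t \<bullet> (m t - \<mu>))"
      unfolding labels[OF t] inner_commute[of \<mu> "x t"] by simp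
  qed
  then show ?thesis
    by (simp add: stoc_regret_def sum_distrib_left sum.distrib sum_subtractf)
qed

text \<open>The deterministic core of the theorem: randomness enters only through the bound on the
  martingale, in which \<open>G\<close> will be R^2 ln (1 / \<delta>).\<close>

lemma ftrl_regret_le_noise:
  fixes x :: "nat \<Rightarrow> real ^ 'n" and A :: real
  defines "lam \<equiv> 4 * A\<^sup>2 * K\<^sup>2 / \<kappa>" and "lev \<equiv> leverage (8 * A\<^sup>2 * K\<^sup>2 / \<kappa>\<^sup>2)"
  assumes A: "0 < A" "\<And>t. t \<in> {1..T} \<Longrightarrow> norm (x t) \<le> A" and B: "norm \<mu> \<le> B"
    and ftrl: "ftrl_iterates \<phi> (lam) x y T m" and pred: "predictors_in D T x m \<mu>"
    and labels: "\<And>t. t \<in> {1..T} \<Longrightarrow> y t = \<phi> (\<mu> \<bullet> x t) + e t"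
    and martingale: "(\<Sum>t=1..T. e t * (x t \<bullet> (m t - \<mu>)))
      \<le> \<kappa> / 4 * (\<Sum>t=1..T. (x t \<bullet> (m t - \<mu>))\<^sup>2) + 2 * G / \<kappa>"
  shows "stoc_regret \<phi> x y m \<mu> T
    \<le> 2 * lam * B\<^sup>2 + 2 / \<kappa> * (\<Sum>t=1..T. (e t)\<^sup>2 * lev x t) + 2 * G / \<kappa>"
proof -
  let ?R = "stoc_regret \<phi> x y m \<mu> T"
  let ?Q = "\<Sum>t=1..T. (x t \<bullet> (m t - \<mu>))\<^sup>2"
  let ?N = "\<Sum>t=1..T. (e t)\<^sup>2 * lev x t"
  have pos: "0 < lam" "0 < 8 * A\<^sup>2 * K\<^sup>2 / \<kappa>\<^sup>2"
    using A(1) K_pos kappa_pos by (simp_all add: lam_def)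
  have "2 * lam / \<kappa> = 8 * A\<^sup>2 * K\<^sup>2 / \<kappa>\<^sup>2"
    by (simp add: lam_def power2_eq_square)
  then have "?R \<le> lam * (norm \<mu>)\<^sup>2
    + (\<Sum>t=1..T. (\<phi> (x t \<bullet> m t) - y t)\<^sup>2 / (2 * \<kappa>) * lev x t)"
    using ftrl_regret_le[OF pos(1) ftrl pred] by (simp add: lev_def)
  also have "lam * (norm \<mu>)\<^sup>2 \<le> lam * B\<^sup>2"
    using pos(1) B by (intro mult_left_mono power_mono) auto
  also have "(\<Sum>t=1..T. (\<phi> (x t \<bullet> m t) - y t)\<^sup>2 / (2 * \<kappa>) * lev x t)
    \<le> (\<Sum>t=1..T. \<kappa> / 8 * (x t \<bullet> (m t - \<mu>))\<^sup>2 + (e t)\<^sup>2 * lev x t / \<kappa>)"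
  proof (rule sum_mono)
    fix t assume t: "t \<in> {1..T}"
    then have D: "x t \<bullet> \<mu> \<in> D" "x t \<bullet> m t \<in> D"
      using pred by (auto simp: predictors_in_def inner_commute)
    let ?f = "\<phi> (x t \<bullet> m t) - \<phi> (x t \<bullet> \<mu>)" and ?l = "lev x t"
    have l: "0 \<le> ?l"
      unfolding lev_def using pos t by (intro leverage_nonneg) auto
    have "?l \<le> A\<^sup>2 / (8 * A\<^sup>2 * K\<^sup>2 / \<kappa>\<^sup>2)"
      unfolding lev_def using pos t A(2) by (intro leverage_le) auto
    also have "\<dots> = \<kappa>\<^sup>2 / (8 * K\<^sup>2)"
      using A(1) by simp
    finally have l': "?l \<le> \<kappa>\<^sup>2 / (8 * K\<^sup>2)" .
    \<comment> \<open>The Lipschitz factor K^2 cancels against the leverage bound.\<close>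
    have "?f\<^sup>2 * ?l \<le> (K\<^sup>2 * (x t \<bullet> (m t - \<mu>))\<^sup>2) * (\<kappa>\<^sup>2 / (8 * K\<^sup>2))"
      using activation_lipschitz[OF D] l l' by (intro mult_mono) (auto simp: inner_diff_right)
    then have f: "?f\<^sup>2 * ?l / \<kappa> \<le> \<kappa> / 8 * (x t \<bullet> (m t - \<mu>))\<^sup>2"
      using K_pos kappa_pos by (simp add: field_simps power2_eq_square)
    have "(\<phi> (x t \<bullet> m t) - y t)\<^sup>2 = (?f - e t)\<^sup>2"
      unfolding labels[OF t] inner_commute[of \<mu> "x t"] by (simp add: algebra_simps)
    also have "\<dots> \<le> 2 * (?f\<^sup>2 + (e t)\<^sup>2)"
      using zero_le_power2[of "?f + e t"] by (simp add: power2_eq_square algebra_simps)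
    finally have "(\<phi> (x t \<bullet> m t) - y t)\<^sup>2 / (2 * \<kappa>) * ?l \<le> 2 * (?f\<^sup>2 + (e t)\<^sup>2) / (2 * \<kappa>) * ?l"
      using l kappa_pos by (intro mult_right_mono divide_right_mono) auto
    also have "\<dots> = ?f\<^sup>2 * ?l / \<kappa> + (e t)\<^sup>2 * ?l / \<kappa>"
      using kappa_pos by (simp add: field_simps)
    finally show "(\<phi> (x t \<bullet> m t) - y t)\<^sup>2 / (2 * \<kappa>) * ?l
      \<le> \<kappa> / 8 * (x t \<bullet> (m t - \<mu>))\<^sup>2 + (e t)\<^sup>2 * ?l / \<kappa>" using f by linarith
  qed
  also have "\<dots> = \<kappa> / 8 * ?Q + ?N / \<kappa>"
    by (simp add: sum.distrib sum_distrib_left sum_divide_distrib)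
  finally have 1: "?R \<le> lam * B\<^sup>2 + (\<kappa> / 8 * ?Q + ?N / \<kappa>)" by simp
  \<comment> \<open>Moving the \<open>\<kappa> / 4\<close> share to the left and halving produces
    exactly the \<open>\<kappa> / 8 * ?Q\<close> of the first bound, at the price of half the
    regret. Solving for the regret doubles the other terms.\<close>
  have "\<kappa> / 2 * ?Q \<le> ?R + (\<kappa> / 4 * ?Q + 2 * (G / \<kappa>))"
    using prediction_error_le[OF pred labels] martingale by fastforce
  then have "\<kappa> / 8 * ?Q \<le> ?R / 2 + G / \<kappa>" by linarith
  with 1 have "?R \<le> 2 * (lam * B\<^sup>2) + 2 * (?N / \<kappa>) + 2 * (G / \<kappa>)" by linarith
  then show ?thesis by simp
qed

end

subsection \<open>Exponential inequalities for adapted noise\<close>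

context prob_space
begin

text \<open>This takes the place of conditional expectation. Independence makes the joint law of the
  history and the noise a product measure, so the noise can be integrated first with the history
  \<open>\<omega>\<close> held fixed.\<close>

lemma nn_integral_indep_le:
  assumes sub: "subalgebra M G" and e: "e \<in> borel_measurable M"
    and indep: "indep_set (sets G) (sets (vimage_algebra (space M) e borel))"
    and g: "g \<in> borel_measurable (G \<Otimes>\<^sub>M borel)"
    and le: "\<And>\<omega>. \<omega> \<in> space M \<Longrightarrow> (\<integral>\<^sup>+\<omega>'. g (\<omega>, e \<omega>') \<partial>M) \<le> h \<omega>"
  shows "(\<integral>\<^sup>+\<omega>. g (\<omega>, e \<omega>) \<partial>M) \<le> (\<integral>\<^sup>+\<omega>. h \<omega> \<partial>M)"
proof -
  have space: "space G = space M" using sub by (simp add: subalgebra_def)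
  have id: "(\<lambda>\<omega>. \<omega>) \<in> measurable M G"
    using sub by (intro measurable_from_subalg[OF sub]) auto
  interpret E: prob_space "distr M borel e" by (rule prob_space_distr[OF e])
  interpret G: prob_space "distr M G (\<lambda>\<omega>. \<omega>)" by (rule prob_space_distr[OF id])
  have pair: "(\<lambda>\<omega>. (\<omega>, e \<omega>)) \<in> measurable M (G \<Otimes>\<^sub>M borel)"
    using id e by (rule measurable_Pair)
  have prod: "distr M G (\<lambda>\<omega>. \<omega>) \<Otimes>\<^sub>M distr M borel e = distr M (G \<Otimes>\<^sub>M borel) (\<lambda>\<omega>. (\<omega>, e \<omega>))"
  proof (rule pair_measure_eqI)
    show "sigma_finite_measure (distr M G (\<lambda>\<omega>. \<omega>))" "sigma_finite_measure (distr M borel e)"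
      by unfold_locales
    show "sets (distr M G (\<lambda>\<omega>. \<omega>) \<Otimes>\<^sub>M distr M borel e) = sets (distr M (G \<Otimes>\<^sub>M borel) (\<lambda>\<omega>. (\<omega>, e \<omega>)))"
      unfolding sets_distr by (rule sets_pair_measure_cong) simp_all
    fix A B assume "A \<in> sets (distr M G (\<lambda>\<omega>. \<omega>))" "B \<in> sets (distr M borel e)"
    then have A: "A \<in> sets G" and B: "B \<in> sets borel" by simp_all
    then have AM: "A \<subseteq> space M" using sets.sets_into_space space by blast
    have "e -` B \<inter> space M \<in> sets (vimage_algebra (space M) e borel)"
      using B by (rule in_vimage_algebra)
    then have "prob (A \<inter> (e -` B \<inter> space M)) = prob A * prob (e -` B \<inter> space M)"
      by (rule indep_setD[OF indep A])
    moreover have "(\<lambda>\<omega>. (\<omega>, e \<omega>)) -` (A \<times> B) \<inter> space M = A \<inter> (e -` B \<inter> space M)"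
      using AM by auto
    moreover have "(\<lambda>\<omega>. \<omega>) -` A \<inter> space M = A" using AM by auto
    ultimately show "emeasure (distr M G (\<lambda>\<omega>. \<omega>)) A * emeasure (distr M borel e) B
      = emeasure (distr M (G \<Otimes>\<^sub>M borel) (\<lambda>\<omega>. (\<omega>, e \<omega>))) (A \<times> B)"
      using A B by (simp add: emeasure_distr[OF id] emeasure_distr[OF e] emeasure_distr[OF pair]
          emeasure_eq_measure ennreal_mult)
  qed
  have "(\<integral>\<^sup>+\<omega>. g (\<omega>, e \<omega>) \<partial>M) = (\<integral>\<^sup>+p. g p \<partial>distr M (G \<Otimes>\<^sub>M borel) (\<lambda>\<omega>. (\<omega>, e \<omega>)))"
    using pair g by (simp add: nn_integral_distr)
  also have "\<dots> = (\<integral>\<^sup>+p. g p \<partial>(distr M G (\<lambda>\<omega>. \<omega>) \<Otimes>\<^sub>M distr M borel e))"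
    by (simp add: prod)
  also have "\<dots> = (\<integral>\<^sup>+\<omega>. \<integral>\<^sup>+z. g (\<omega>, z) \<partial>distr M borel e \<partial>distr M G (\<lambda>\<omega>. \<omega>))"
    using g by (intro E.nn_integral_fst[symmetric]) (simp cong: measurable_cong_sets)
  also have "\<dots> = (\<integral>\<^sup>+\<omega>. \<integral>\<^sup>+z. g (\<omega>, z) \<partial>distr M borel e \<partial>M)"
    using id g by (intro nn_integral_distr E.borel_measurable_nn_integral_fst[of g G])
      (simp_all cong: measurable_cong_sets)
  also have "\<dots> \<le> (\<integral>\<^sup>+\<omega>. h \<omega> \<partial>M)"
  proof (rule nn_integral_mono)
    fix \<omega> assume \<omega>: "\<omega> \<in> space M"
    then have "(\<lambda>z. g (\<omega>, z)) \<in> borel_measurable borel"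
      using g space by (intro measurable_compose[OF measurable_Pair1'[of \<omega> G borel] g]) simp
    then show "(\<integral>\<^sup>+z. g (\<omega>, z) \<partial>distr M borel e) \<le> h \<omega>"
      using le[OF \<omega>] e by (subst nn_integral_distr) auto
  qed
  finally show ?thesis .
qed

lemma online_protocol_measurable_le:
  assumes protocol: "online_protocol M F T x \<mu>hat \<epsilon>" and "s \<le> t" and "f \<in> measurable (F s) N"
  shows "f \<in> measurable (F t) N"
proof -
  have "filtration (space M) F" using protocol by (simp add: online_protocol_def)
  then have "space (F s) = space (F t)" "sets (F s) \<subseteq> sets (F t)"
    using assms(2) filtration.space_F[of "space M" F] filtration.sets_F_mono[of "space M" F s t] by auto
  with assms(3) show ?thesis unfolding measurable_def by auto
qed

text \<open>The exponentials of the partial sums form a supermartingale: given the history, each new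
  factor has mean at most 1. Measurability of the sum in \<open>F n\<close> is proved along with the
  bound because the next step freezes that sum as part of the history.\<close>

lemma nn_integral_exp_sum_le_1:
  assumes protocol: "online_protocol M F T x \<mu>hat \<epsilon>"
    and g: "\<And>t. t \<in> {1..T} \<Longrightarrow> g t \<in> borel_measurable (F (t - 1) \<Otimes>\<^sub>M borel)"
    and le: "\<And>t \<omega>. t \<in> {1..T} \<Longrightarrow> \<omega> \<in> space M \<Longrightarrow> (\<integral>\<^sup>+\<omega>'. ennreal (exp (g t (\<omega>, \<epsilon> t \<omega>'))) \<partial>M) \<le> 1"
    and "n \<le> T"
  shows "(\<lambda>\<omega>. \<Sum>t=1..n. g t (\<omega>, \<epsilon> t \<omega>)) \<in> borel_measurable (F n)
    \<and> (\<integral>\<^sup>+\<omega>. ennreal (exp (\<Sum>t=1..n. g t (\<omega>, \<epsilon> t \<omega>))) \<partial>M) \<le> 1"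
  using \<open>n \<le> T\<close>
proof (induction n)
  case 0
  then show ?case by (simp add: emeasure_space_1)
next
  case (Suc n)
  have sub: "subalgebra M (F t)" for t
    using protocol by (simp add: online_protocol_def)
  have Suc_in: "Suc n \<in> {1..T}" using Suc.prems by simp
  have eF: "\<epsilon> (Suc n) \<in> borel_measurable (F (Suc n))"
    and indep: "indep_set (sets (F n)) (sets (vimage_algebra (space M) (\<epsilon> (Suc n)) borel))"
    using conjunct2[OF conjunct2[OF protocol[unfolded online_protocol_def]], THEN bspec, OF Suc_in]
    by simp_all
  have gn: "g (Suc n) \<in> borel_measurable (F n \<Otimes>\<^sub>M borel)"
    using g[OF Suc_in] by simp
  let ?S = "\<lambda>\<omega>. \<Sum>t=1..n. g t (\<omega>, \<epsilon> t \<omega>)"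
  have S: "?S \<in> borel_measurable (F n)" and IH: "(\<integral>\<^sup>+\<omega>. ennreal (exp (?S \<omega>)) \<partial>M) \<le> 1"
    using Suc.IH Suc.prems by simp_all
  have "(\<lambda>\<omega>. (\<omega>, \<epsilon> (Suc n) \<omega>)) \<in> measurable (F (Suc n)) (F n \<Otimes>\<^sub>M borel)"
    by (rule measurable_Pair[OF online_protocol_measurable_le[OF protocol _ measurable_ident_sets] eF])
      simp_all
  then have "(\<lambda>\<omega>. g (Suc n) (\<omega>, \<epsilon> (Suc n) \<omega>)) \<in> borel_measurable (F (Suc n))"
    by (rule measurable_compose[OF _ gn])
  moreover have "?S \<in> borel_measurable (F (Suc n))"
    by (rule online_protocol_measurable_le[OF protocol _ S]) simp
  ultimately have meas: "(\<lambda>\<omega>. \<Sum>t=1..Suc n. g t (\<omega>, \<epsilon> t \<omega>)) \<in> borel_measurable (F (Suc n))"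
    by simp
  let ?g = "\<lambda>(\<omega>, z). ennreal (exp (?S \<omega>)) * ennreal (exp (g (Suc n) (\<omega>, z)))"
  have "(\<integral>\<^sup>+\<omega>. ennreal (exp (\<Sum>t=1..Suc n. g t (\<omega>, \<epsilon> t \<omega>))) \<partial>M) = (\<integral>\<^sup>+\<omega>. ?g (\<omega>, \<epsilon> (Suc n) \<omega>) \<partial>M)"
    by (simp add: exp_add ennreal_mult)
  also have "\<dots> \<le> (\<integral>\<^sup>+\<omega>. ennreal (exp (?S \<omega>)) \<partial>M)"
  proof (rule nn_integral_indep_le[OF sub _ indep])
    show e: "\<epsilon> (Suc n) \<in> borel_measurable M"
      by (rule measurable_from_subalg[OF sub eF])
    show "?g \<in> borel_measurable (F n \<Otimes>\<^sub>M borel)"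
      using S gn by (simp add: case_prod_beta') measurable
    fix \<omega> assume \<omega>: "\<omega> \<in> space M"
    have "(\<lambda>z. g (Suc n) (\<omega>, z)) \<in> borel_measurable borel"
      using \<omega> sub[of n] by (intro measurable_compose[OF measurable_Pair1'[of \<omega> "F n" borel] gn])
        (simp add: subalgebra_def)
    with e have [measurable]: "(\<lambda>\<omega>'. g (Suc n) (\<omega>, \<epsilon> (Suc n) \<omega>')) \<in> borel_measurable M"
      by (rule measurable_compose)
    have "(\<integral>\<^sup>+\<omega>'. ?g (\<omega>, \<epsilon> (Suc n) \<omega>') \<partial>M)
      = ennreal (exp (?S \<omega>)) * (\<integral>\<^sup>+\<omega>'. ennreal (exp (g (Suc n) (\<omega>, \<epsilon> (Suc n) \<omega>'))) \<partial>M)"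
      by (simp add: nn_integral_cmult)
    also have "\<dots> \<le> ennreal (exp (?S \<omega>)) * 1"
      by (intro mult_left_mono le Suc_in \<omega>) simp
    finally show "(\<integral>\<^sup>+\<omega>'. ?g (\<omega>, \<epsilon> (Suc n) \<omega>') \<partial>M) \<le> ennreal (exp (?S \<omega>))" by simp
  qed
  also note IH
  finally show ?case using meas by simp
qed

text \<open>Markov's inequality for the exponential of the sum at level 1 / \<delta>.\<close>

lemma prob_exp_martingale_ge:
  assumes protocol: "online_protocol M F T x \<mu>hat \<epsilon>"
    and g: "\<And>t. t \<in> {1..T} \<Longrightarrow> g t \<in> borel_measurable (F (t - 1) \<Otimes>\<^sub>M borel)"
    and le: "\<And>t \<omega>. t \<in> {1..T} \<Longrightarrow> \<omega> \<in> space M \<Longrightarrow> (\<integral>\<^sup>+\<omega>'. ennreal (exp (g t (\<omega>, \<epsilon> t \<omega>'))) \<partial>M) \<le> 1"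
    and "0 < \<delta>"
  shows "1 - \<delta> \<le> prob {\<omega> \<in> space M. (\<Sum>t=1..T. g t (\<omega>, \<epsilon> t \<omega>)) < ln (1 / \<delta>)}"
proof -
  let ?S = "\<lambda>\<omega>. \<Sum>t=1..T. g t (\<omega>, \<epsilon> t \<omega>)"
  have "subalgebra M (F T)" using protocol by (simp add: online_protocol_def)
  moreover have "?S \<in> borel_measurable (F T)" and int: "(\<integral>\<^sup>+\<omega>. ennreal (exp (?S \<omega>)) \<partial>M) \<le> 1"
    using nn_integral_exp_sum_le_1[OF protocol g le order_refl] by auto
  ultimately have S[measurable]: "?S \<in> borel_measurable M"
    using measurable_from_subalg by blast
  let ?A = "{\<omega> \<in> space M. ?S \<omega> < ln (1 / \<delta>)}"
  have "space M - ?A = {\<omega> \<in> space M. 1 \<le> ennreal \<delta> * ennreal (exp (?S \<omega>))}"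
  proof -
    have "1 \<le> ennreal \<delta> * ennreal (exp r) \<longleftrightarrow> \<not> r < ln (1 / \<delta>)" for r
    proof -
      have "1 \<le> ennreal \<delta> * ennreal (exp r) \<longleftrightarrow> 1 \<le> \<delta> * exp r"
        using \<open>0 < \<delta>\<close> by (simp add: ennreal_mult[symmetric] ennreal_1[symmetric] del: ennreal_1)
      also have "\<dots> \<longleftrightarrow> 1 / \<delta> \<le> exp r"
        using \<open>0 < \<delta>\<close> by (simp add: field_simps)
      also have "\<dots> \<longleftrightarrow> exp (ln (1 / \<delta>)) \<le> exp r"
        using \<open>0 < \<delta>\<close> by (subst exp_ln) simp_all
      also have "\<dots> \<longleftrightarrow> ln (1 / \<delta>) \<le> r"
        by (rule exp_le_cancel_iff)
      finally show ?thesis by auto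
    qed
    then show ?thesis by auto
  qed
  moreover have "(\<lambda>\<omega>. ennreal (exp (?S \<omega>)) * indicator (space M) \<omega>) \<in> borel_measurable M"
    by measurable
  ultimately have "emeasure M (space M - ?A) \<le> ennreal \<delta> * (\<integral>\<^sup>+\<omega>. ennreal (exp (?S \<omega>)) * indicator (space M) \<omega> \<partial>M)"
    using nn_integral_Markov_inequality[of "\<lambda>\<omega>. ennreal (exp (?S \<omega>))" "space M" M "ennreal \<delta>"] by simp
  also have "(\<integral>\<^sup>+\<omega>. ennreal (exp (?S \<omega>)) * indicator (space M) \<omega> \<partial>M) = (\<integral>\<^sup>+\<omega>. ennreal (exp (?S \<omega>)) \<partial>M)"
    by (intro nn_integral_cong) simp
  also have "ennreal \<delta> * \<dots> \<le> ennreal \<delta> * 1"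
    by (intro mult_left_mono int) simp
  finally have "prob (space M - ?A) \<le> \<delta>"
    using \<open>0 < \<delta>\<close> by (simp add: emeasure_eq_measure)
  moreover have "?A \<in> events" by measurable
  ultimately show ?thesis by (simp add: prob_compl)
qed

text \<open>Hoeffding's lemma on an interval of length 2 R, where l^2 (2 R)^2 / 8 is l^2 R^2 / 2. It
  is applied with a positive parameter; a negative \<open>l\<close> is handled by passing to
  \<open>- e\<close>.\<close>

lemma nn_integral_exp_bounded_centered:
  fixes e :: "'a \<Rightarrow> real"
  assumes [measurable]: "e \<in> borel_measurable M" and bound: "AE \<omega> in M. \<bar>e \<omega>\<bar> \<le> R" and mean: "expectation e = 0"
  shows "(\<integral>\<^sup>+\<omega>. ennreal (exp (l * e \<omega>)) \<partial>M) \<le> ennreal (exp (l\<^sup>2 * R\<^sup>2 / 2))"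
proof -
  have pos: "(\<integral>\<^sup>+\<omega>. ennreal (exp (k * f \<omega>)) \<partial>M) \<le> ennreal (exp (k\<^sup>2 * R\<^sup>2 / 2))"
    if "0 < k" "f \<in> borel_measurable M" "AE \<omega> in M. \<bar>f \<omega>\<bar> \<le> R" "expectation f = 0" for k and f :: "'a \<Rightarrow> real"
  proof -
    interpret interval_bounded_random_variable M f "- R" R
      using that by unfold_locales (auto elim!: eventually_mono)
    show ?thesis
      using Hoeffdings_lemma_nn_integral_0[OF \<open>0 < k\<close> \<open>expectation f = 0\<close>]
      by (simp add: power2_eq_square field_simps)
  qed
  consider "0 < l" | "l = 0" | "l < 0" by linarith
  then show ?thesis
  proof cases
    case 1
    then show ?thesis using bound mean by (intro pos) auto
  next
    case 2
    then show ?thesis by (simp add: emeasure_space_1)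
  next
    case 3
    then show ?thesis using pos[of "- l" "\<lambda>\<omega>. - e \<omega>"] bound mean by simp
  qed
qed

text \<open>On [0, 1] the exponential satisfies exp r <= 1 + r + r^2 <= 1 + 2 r. Taking expectations
  and using 1 + r <= exp r gives a bound in terms of the variance, with the factor 2 as the
  loss.\<close>

lemma nn_integral_exp_square_le:
  fixes e :: "'a \<Rightarrow> real"
  assumes [measurable]: "e \<in> borel_measurable M" and bound: "AE \<omega> in M. \<bar>e \<omega>\<bar> \<le> R"
    and var: "expectation (\<lambda>\<omega>. (e \<omega>)\<^sup>2) \<le> v" and s: "0 \<le> s" "s * R\<^sup>2 \<le> 1"
  shows "(\<integral>\<^sup>+\<omega>. ennreal (exp (s * (e \<omega>)\<^sup>2)) \<partial>M) \<le> ennreal (exp (2 * s * v))"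
proof -
  have sq: "AE \<omega> in M. (e \<omega>)\<^sup>2 \<le> R\<^sup>2"
    using bound by (elim eventually_mono) (use power_mono[of "\<bar>e _\<bar>" R 2] in simp)
  have int: "integrable M (\<lambda>\<omega>. (e \<omega>)\<^sup>2)"
    using sq by (intro integrable_const_bound[of _ "R\<^sup>2"]) auto
  have "(\<integral>\<^sup>+\<omega>. ennreal (exp (s * (e \<omega>)\<^sup>2)) \<partial>M) \<le> (\<integral>\<^sup>+\<omega>. ennreal (1 + 2 * (s * (e \<omega>)\<^sup>2)) \<partial>M)"
  proof (rule nn_integral_mono_AE, use sq in eventually_elim)
    fix \<omega> assume "(e \<omega>)\<^sup>2 \<le> R\<^sup>2"
    then have "s * (e \<omega>)\<^sup>2 \<le> 1"
      using s mult_left_mono[of "(e \<omega>)\<^sup>2" "R\<^sup>2" s] by simp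
    moreover have "0 \<le> s * (e \<omega>)\<^sup>2" using s by simp
    moreover from calculation have "(s * (e \<omega>)\<^sup>2)\<^sup>2 \<le> s * (e \<omega>)\<^sup>2"
      by (simp add: power2_eq_square mult_left_le)
    ultimately have "exp (s * (e \<omega>)\<^sup>2) \<le> 1 + 2 * (s * (e \<omega>)\<^sup>2)"
      using exp_bound[of "s * (e \<omega>)\<^sup>2"] by linarith
    then show "ennreal (exp (s * (e \<omega>)\<^sup>2)) \<le> ennreal (1 + 2 * (s * (e \<omega>)\<^sup>2))"
      by (rule ennreal_leI)
  qed
  also have "\<dots> = ennreal (expectation (\<lambda>\<omega>. 1 + 2 * (s * (e \<omega>)\<^sup>2)))"
    using int s by (intro nn_integral_eq_integral) auto
  also have "expectation (\<lambda>\<omega>. 1 + 2 * (s * (e \<omega>)\<^sup>2)) = 1 + 2 * s * expectation (\<lambda>\<omega>. (e \<omega>)\<^sup>2)"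
    using int by (simp add: prob_space)
  also have "\<dots> \<le> 1 + 2 * s * v"
    using s var by (simp add: mult_left_mono)
  also have "\<dots> \<le> exp (2 * s * v)"
    by (rule exp_ge_add_one_self)
  finally show ?thesis by (simp add: ennreal_leI)
qed

end

section \<open>Measurability of the leverages and of the regret\<close>

lemma borel_measurable_leverage:
  fixes x :: "nat \<Rightarrow> 'a \<Rightarrow> real ^ 'n"
  assumes "\<And>\<tau>. \<tau> \<in> {1..t} \<Longrightarrow> x \<tau> \<in> borel_measurable N"
  shows "(\<lambda>\<omega>. leverage c (\<lambda>\<tau>. x \<tau> \<omega>) t) \<in> borel_measurable N"
proof -
  have comp: "(\<lambda>\<omega>. x \<tau> \<omega> $ i) \<in> borel_measurable N" if "\<tau> \<in> {1..t}" for \<tau> i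
  proof -
    have "(\<lambda>\<omega>. x \<tau> \<omega> \<bullet> axis i 1) \<in> borel_measurable N"
      using assms[OF that] by measurable
    then show ?thesis by (simp add: inner_axis)
  qed
  \<comment> \<open>By the Leibniz formula the determinant is a polynomial in the components of the
    features.\<close>
  have "(\<lambda>\<omega>. det (reg_gram c (\<lambda>\<tau>. x \<tau> \<omega>) s)) \<in> borel_measurable N" if "s \<le> t" for s
    unfolding det_def reg_gram_component
    using that by (intro borel_measurable_sum borel_measurable_prod borel_measurable_times
        borel_measurable_add borel_measurable_const comp) auto
  then show ?thesis
    unfolding leverage_def by (intro borel_measurable_diff borel_measurable_const borel_measurable_divide) auto
qed

text \<open>The final comparison of probabilities requires the regret bound to define an
  event.\<close>

lemma (in interval_activation) borel_measurable_stoc_regret: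
  fixes x :: "nat \<Rightarrow> 'a \<Rightarrow> real ^ 'n"
  assumes "\<And>t. t \<in> {1..T} \<Longrightarrow> x t \<in> borel_measurable N" "\<And>t. t \<in> {1..T} \<Longrightarrow> m t \<in> borel_measurable N"
    "\<And>t. t \<in> {1..T} \<Longrightarrow> e t \<in> borel_measurable N"
    and pred: "\<And>\<omega>. \<omega> \<in> space N \<Longrightarrow> predictors_in D T (\<lambda>t. x t \<omega>) (\<lambda>t. m t \<omega>) \<mu>"
    and labels: "\<And>t \<omega>. t \<in> {1..T} \<Longrightarrow> \<omega> \<in> space N \<Longrightarrow> y t \<omega> = \<phi> (\<mu> \<bullet> x t \<omega>) + e t \<omega>"
  shows "(\<lambda>\<omega>. stoc_regret \<phi> (\<lambda>t. x t \<omega>) (\<lambda>t. y t \<omega>) (\<lambda>t. m t \<omega>) \<mu> T) \<in> borel_measurable N"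
proof -
  \<comment> \<open>Continuity of the activation and its primitive is known on \<open>D\<close>
    only, so the predictor is regarded as a map into the subspace \<open>D\<close>.\<close>
  have comp: "(\<lambda>\<omega>. f (r \<omega>)) \<in> borel_measurable N"
    if "continuous_on D f" "r \<in> borel_measurable N" "\<And>\<omega>. \<omega> \<in> space N \<Longrightarrow> r \<omega> \<in> D" for f r :: "_ \<Rightarrow> real"
  proof -
    have "r \<in> measurable N (restrict_space borel D)"
      using that by (intro measurable_restrict_space2) auto
    then show ?thesis
      by (rule measurable_compose) (rule borel_measurable_continuous_on_restrict[OF that(1)])
  qed
  have xm: "(\<lambda>\<omega>. x t \<omega> \<bullet> \<mu>) \<in> borel_measurable N" "(\<lambda>\<omega>. x t \<omega> \<bullet> m t \<omega>) \<in> borel_measurable N"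
    if "t \<in> {1..T}" for t
    using assms(1,2)[OF that] by measurable
  have D: "x t \<omega> \<bullet> \<mu> \<in> D" "x t \<omega> \<bullet> m t \<omega> \<in> D" if "t \<in> {1..T}" "\<omega> \<in> space N" for t \<omega>
    using pred[OF that(2)] that(1) by (auto simp: predictors_in_def inner_commute)
  have y: "y t \<in> borel_measurable N" if t: "t \<in> {1..T}" for t
  proof -
    have "(\<lambda>\<omega>. \<phi> (x t \<omega> \<bullet> \<mu>) + e t \<omega>) \<in> borel_measurable N"
      by (intro borel_measurable_add comp[OF continuous_on_activation] xm[OF t] D[OF t] assms(3)[OF t])
    moreover have "y t \<in> borel_measurable N \<longleftrightarrow> (\<lambda>\<omega>. \<phi> (x t \<omega> \<bullet> \<mu>) + e t \<omega>) \<in> borel_measurable N"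
      using labels[OF t] by (intro measurable_cong) (simp add: inner_commute)
    ultimately show ?thesis by simp
  qed
  show ?thesis
    unfolding stoc_regret_def glm_loss_eq
    by (rule borel_measurable_diff; rule borel_measurable_sum; rule borel_measurable_add)
      (rule borel_measurable_times y borel_measurable_uminus comp[OF continuous_on_primitive] xm D
        | assumption)+
qed

subsection \<open>High-probability bounds on the noise terms\<close>

context prob_space
begin

lemma nn_integral_exp_minus_le_1:
  fixes f :: "'a \<Rightarrow> real"
  assumes [measurable]: "f \<in> borel_measurable M"
    and le: "(\<integral>\<^sup>+\<omega>. ennreal (exp (f \<omega>)) \<partial>M) \<le> ennreal (exp b)"
  shows "(\<integral>\<^sup>+\<omega>. ennreal (exp (f \<omega> - b)) \<partial>M) \<le> 1"
proof -
  have "(\<integral>\<^sup>+\<omega>. ennreal (exp (f \<omega> - b)) \<partial>M) = (\<integral>\<^sup>+\<omega>. ennreal (exp (- b)) * ennreal (exp (f \<omega>)) \<partial>M)"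
    by (simp add: ennreal_mult[symmetric] exp_add[symmetric])
  also have "\<dots> = ennreal (exp (- b)) * (\<integral>\<^sup>+\<omega>. ennreal (exp (f \<omega>)) \<partial>M)"
    by (rule nn_integral_cmult) measurable
  also have "\<dots> \<le> ennreal (exp (- b)) * ennreal (exp b)"
    by (intro mult_left_mono le) simp
  also have "\<dots> = 1"
    by (simp add: ennreal_mult[symmetric] exp_add[symmetric])
  finally show ?thesis .
qed

lemma online_protocol_measurable:
  assumes "online_protocol M F T x \<mu>hat \<epsilon>" and "t \<in> {1..T}"
  shows "x t \<in> borel_measurable (F (t - 1))" "\<mu>hat t \<in> borel_measurable (F (t - 1))"
    "\<epsilon> t \<in> borel_measurable (F t)" "\<epsilon> t \<in> borel_measurable M"
    "f \<in> measurable (F s) N \<Longrightarrow> f \<in> measurable M N"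
proof -
  have sub: "subalgebra M (F s)" for s
    using assms(1) by (simp add: online_protocol_def)
  show "x t \<in> borel_measurable (F (t - 1))" "\<mu>hat t \<in> borel_measurable (F (t - 1))"
    "\<epsilon> t \<in> borel_measurable (F t)"
    using conjunct2[OF conjunct2[OF assms(1)[unfolded online_protocol_def]], THEN bspec, OF assms(2)]
    by simp_all
  then show "\<epsilon> t \<in> borel_measurable M"
    by (intro measurable_from_subalg[OF sub])
  show "f \<in> measurable M N" if "f \<in> measurable (F s) N"
    using sub that by (rule measurable_from_subalg)
qed

lemma martingale_noise_bound:
  assumes protocol: "online_protocol M F T x \<mu>hat \<epsilon>"
    and u: "\<And>t. t \<in> {1..T} \<Longrightarrow> u t \<in> borel_measurable (F (t - 1))"
    and bound: "\<And>t. t \<in> {1..T} \<Longrightarrow> AE \<omega> in M. \<bar>\<epsilon> t \<omega>\<bar> \<le> R"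
    and mean: "\<And>t. t \<in> {1..T} \<Longrightarrow> expectation (\<epsilon> t) = 0"
    and pos: "0 < \<kappa>" "0 < \<delta>"
  shows "1 - \<delta> \<le> prob {\<omega> \<in> space M. (\<Sum>t=1..T. \<epsilon> t \<omega> * u t \<omega>)
    \<le> \<kappa> / 4 * (\<Sum>t=1..T. (u t \<omega>)\<^sup>2) + 2 * (R\<^sup>2 * ln (1 / \<delta>)) / \<kappa>}"
    (is "_ \<le> prob ?G")
proof -
  have eM: "\<epsilon> t \<in> borel_measurable M" and uM: "u t \<in> borel_measurable M" if "t \<in> {1..T}" for t
    using online_protocol_measurable[OF protocol that] u[OF that] by blast+
  have meas: "?G \<in> events"
    by (intro borel_measurable_le borel_measurable_add borel_measurable_times borel_measurable_sum
        borel_measurable_power borel_measurable_const eM uM)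
  show ?thesis
  proof (cases "R = 0")
    \<comment> \<open>The scale chosen in the other case divides by R^2; here the noise vanishes
      almost surely.\<close>
    case True
    have "AE \<omega> in M. \<forall>t\<in>{1..T}. \<epsilon> t \<omega> = 0"
      using bound True by (intro AE_finite_allI) auto
    then have "AE \<omega> in M. \<omega> \<in> ?G"
      using AE_space
    proof eventually_elim
      case (elim \<omega>)
      have "(\<Sum>t=1..T. \<epsilon> t \<omega> * u t \<omega>) = 0"
        using elim(1) by (intro sum.neutral) auto
      moreover have "0 \<le> \<kappa> / 4 * (\<Sum>t=1..T. (u t \<omega>)\<^sup>2)"
        using pos by (intro mult_nonneg_nonneg sum_nonneg) auto
      ultimately show ?case using elim(2) True by simp
    qed
    then have "prob ?G = 1" using meas by (simp add: prob_eq_1)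
    then show ?thesis using pos by simp
  next
    case False
    \<comment> \<open>This scale makes the Hoeffding compensator a^2 R^2 / 2 equal to
      \<open>a * (\<kappa> / 4)\<close>; dividing by \<open>a\<close> turns ln (1 / \<delta>) into
      the stated deviation.\<close>
    define a where "a = \<kappa> / (2 * R\<^sup>2)"
    have a: "0 < a" using pos False by (simp add: a_def)
    define g where "g t p = a * u t (fst p) * snd p - (a * u t (fst p))\<^sup>2 * R\<^sup>2 / 2" for t and p :: "'a \<times> real"
    have "1 - \<delta> \<le> prob {\<omega> \<in> space M. (\<Sum>t=1..T. g t (\<omega>, \<epsilon> t \<omega>)) < ln (1 / \<delta>)}"
    proof (rule prob_exp_martingale_ge[OF protocol _ _ pos(2)])
      fix t assume t: "t \<in> {1..T}"
      note [measurable] = u[OF t] eM[OF t]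
      show "g t \<in> borel_measurable (F (t - 1) \<Otimes>\<^sub>M borel)"
        unfolding g_def[abs_def] by measurable
      fix \<omega> assume "\<omega> \<in> space M"
      show "(\<integral>\<^sup>+\<omega>'. ennreal (exp (g t (\<omega>, \<epsilon> t \<omega>'))) \<partial>M) \<le> 1"
        unfolding g_def fst_conv snd_conv
        by (intro nn_integral_exp_minus_le_1 nn_integral_exp_bounded_centered bound[OF t] mean[OF t])
          measurable
    qed
    also have "\<dots> \<le> prob ?G"
    proof (rule finite_measure_mono[OF _ meas], safe)
      fix \<omega> assume "(\<Sum>t=1..T. g t (\<omega>, \<epsilon> t \<omega>)) < ln (1 / \<delta>)"
      moreover have "(\<Sum>t=1..T. g t (\<omega>, \<epsilon> t \<omega>))
        = a * (\<Sum>t=1..T. \<epsilon> t \<omega> * u t \<omega>) - a\<^sup>2 * R\<^sup>2 / 2 * (\<Sum>t=1..T. (u t \<omega>)\<^sup>2)"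
        unfolding g_def sum_subtractf sum_distrib_left fst_conv snd_conv
        by (intro arg_cong2[where f = "(-)"] sum.cong) (simp_all add: power_mult_distrib)
      moreover have "a\<^sup>2 * R\<^sup>2 / 2 = a * (\<kappa> / 4)"
        using False by (simp add: a_def power2_eq_square)
      ultimately have "a * ((\<Sum>t=1..T. \<epsilon> t \<omega> * u t \<omega>) - \<kappa> / 4 * (\<Sum>t=1..T. (u t \<omega>)\<^sup>2)) < ln (1 / \<delta>)"
        by (simp only: right_diff_distrib mult.assoc)
      then have "(\<Sum>t=1..T. \<epsilon> t \<omega> * u t \<omega>) - \<kappa> / 4 * (\<Sum>t=1..T. (u t \<omega>)\<^sup>2) < ln (1 / \<delta>) / a"
        using a by (simp only: pos_less_divide_eq mult.commute)
      also have "ln (1 / \<delta>) / a = 2 * (R\<^sup>2 * ln (1 / \<delta>)) / \<kappa>"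
        by (simp add: a_def)
      finally show "(\<Sum>t=1..T. \<epsilon> t \<omega> * u t \<omega>)
        \<le> \<kappa> / 4 * (\<Sum>t=1..T. (u t \<omega>)\<^sup>2) + 2 * (R\<^sup>2 * ln (1 / \<delta>)) / \<kappa>" by linarith
    qed
    finally show ?thesis .
  qed
qed

lemma squared_noise_bound:
  assumes protocol: "online_protocol M F T x \<mu>hat \<epsilon>"
    and w: "\<And>t. t \<in> {1..T} \<Longrightarrow> w t \<in> borel_measurable (F (t - 1))"
    and w_bounds: "\<And>t \<omega>. t \<in> {1..T} \<Longrightarrow> \<omega> \<in> space M \<Longrightarrow> 0 \<le> w t \<omega>"
      "\<And>t \<omega>. t \<in> {1..T} \<Longrightarrow> \<omega> \<in> space M \<Longrightarrow> w t \<omega> \<le> b"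
    and bound: "\<And>t. t \<in> {1..T} \<Longrightarrow> AE \<omega> in M. \<bar>\<epsilon> t \<omega>\<bar> \<le> R"
    and var: "\<And>t. t \<in> {1..T} \<Longrightarrow> expectation (\<lambda>\<omega>. (\<epsilon> t \<omega>)\<^sup>2) \<le> v"
    and pos: "0 < b" "0 \<le> v" "0 < \<delta>"
  shows "1 - \<delta> \<le> prob {\<omega> \<in> space M. (\<Sum>t=1..T. (\<epsilon> t \<omega>)\<^sup>2 * w t \<omega>)
    \<le> 2 * v * (\<Sum>t=1..T. w t \<omega>) + b * R\<^sup>2 * ln (1 / \<delta>)}"
    (is "_ \<le> prob ?G")
proof -
  have eM: "\<epsilon> t \<in> borel_measurable M" and wM: "w t \<in> borel_measurable M" if "t \<in> {1..T}" for t
    using online_protocol_measurable[OF protocol that] w[OF that] by blast+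
  have meas: "?G \<in> events"
    by (intro borel_measurable_le borel_measurable_add borel_measurable_times borel_measurable_sum
        borel_measurable_power borel_measurable_const eM wM)
  show ?thesis
  proof (cases "R = 0")
    case True
    have "AE \<omega> in M. \<forall>t\<in>{1..T}. \<epsilon> t \<omega> = 0"
      using bound True by (intro AE_finite_allI) auto
    then have "AE \<omega> in M. \<omega> \<in> ?G"
      using AE_space
    proof eventually_elim
      case (elim \<omega>)
      have "(\<Sum>t=1..T. (\<epsilon> t \<omega>)\<^sup>2 * w t \<omega>) = 0"
        using elim(1) by (intro sum.neutral) auto
      moreover have "0 \<le> 2 * v * (\<Sum>t=1..T. w t \<omega>)"
        using pos w_bounds(1) elim(2) by (intro mult_nonneg_nonneg sum_nonneg) auto
      ultimately show ?case using elim(2) True by simp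
    qed
    then have "prob ?G = 1" using meas by (simp add: prob_eq_1)
    then show ?thesis using pos by simp
  next
    case False
    \<comment> \<open>The largest scale for which every weight up to \<open>b\<close> satisfies the
      smallness condition of \<open>nn_integral_exp_square_le\<close>. The factor 2 in front of
      \<open>v\<close> comes from that lemma.\<close>
    define s where "s = 1 / (b * R\<^sup>2)"
    have s: "0 < s" using pos False by (simp add: s_def)
    define g where "g t p = s * w t (fst p) * (snd p)\<^sup>2 - 2 * (s * w t (fst p)) * v" for t and p :: "'a \<times> real"
    have "1 - \<delta> \<le> prob {\<omega> \<in> space M. (\<Sum>t=1..T. g t (\<omega>, \<epsilon> t \<omega>)) < ln (1 / \<delta>)}"
    proof (rule prob_exp_martingale_ge[OF protocol _ _ pos(3)])
      fix t assume t: "t \<in> {1..T}"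
      note [measurable] = w[OF t] eM[OF t]
      show "g t \<in> borel_measurable (F (t - 1) \<Otimes>\<^sub>M borel)"
        unfolding g_def[abs_def] by measurable
      fix \<omega> assume \<omega>: "\<omega> \<in> space M"
      have "s * w t \<omega> * R\<^sup>2 \<le> s * b * R\<^sup>2"
        using s w_bounds(2)[OF t \<omega>] by (intro mult_right_mono mult_left_mono) auto
      also have "\<dots> = 1" using pos False by (simp add: s_def)
      finally have small: "s * w t \<omega> * R\<^sup>2 \<le> 1" .
      have nonneg: "0 \<le> s * w t \<omega>" using s w_bounds(1)[OF t \<omega>] by simp
      show "(\<integral>\<^sup>+\<omega>'. ennreal (exp (g t (\<omega>, \<epsilon> t \<omega>'))) \<partial>M) \<le> 1"
        unfolding g_def fst_conv snd_conv
      proof (rule nn_integral_exp_minus_le_1)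
        show "(\<lambda>\<omega>'. s * w t \<omega> * (\<epsilon> t \<omega>')\<^sup>2) \<in> borel_measurable M" by measurable
        show "(\<integral>\<^sup>+\<omega>'. ennreal (exp (s * w t \<omega> * (\<epsilon> t \<omega>')\<^sup>2)) \<partial>M) \<le> ennreal (exp (2 * (s * w t \<omega>) * v))"
          by (rule nn_integral_exp_square_le[OF eM[OF t] bound[OF t] var[OF t] nonneg small])
      qed
    qed
    also have "\<dots> \<le> prob ?G"
    proof (rule finite_measure_mono[OF _ meas], safe)
      fix \<omega> assume "(\<Sum>t=1..T. g t (\<omega>, \<epsilon> t \<omega>)) < ln (1 / \<delta>)"
      moreover have "(\<Sum>t=1..T. g t (\<omega>, \<epsilon> t \<omega>))
        = s * ((\<Sum>t=1..T. (\<epsilon> t \<omega>)\<^sup>2 * w t \<omega>) - 2 * v * (\<Sum>t=1..T. w t \<omega>))"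
        unfolding g_def sum_subtractf sum_distrib_left right_diff_distrib fst_conv snd_conv
        by (intro arg_cong2[where f = "(-)"] sum.cong) simp_all
      ultimately have "(\<Sum>t=1..T. (\<epsilon> t \<omega>)\<^sup>2 * w t \<omega>) - 2 * v * (\<Sum>t=1..T. w t \<omega>) < ln (1 / \<delta>) / s"
        using s by (simp only: pos_less_divide_eq mult.commute)
      also have "ln (1 / \<delta>) / s = b * R\<^sup>2 * ln (1 / \<delta>)"
        by (simp add: s_def)
      finally show "(\<Sum>t=1..T. (\<epsilon> t \<omega>)\<^sup>2 * w t \<omega>)
        \<le> 2 * v * (\<Sum>t=1..T. w t \<omega>) + b * R\<^sup>2 * ln (1 / \<delta>)" by linarith
    qed
    finally show ?thesis .
  qed
qed

lemma prob_Int_ge: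
  assumes "A \<in> events" "B \<in> events"
  shows "prob A + prob B - 1 \<le> prob (A \<inter> B)"
proof -
  have "prob (A - B) \<le> prob (space M - B)"
    using assms sets.sets_into_space by (intro finite_measure_mono) auto
  then show ?thesis
    using assms by (simp add: finite_measure_Diff' prob_compl prob_space)
qed

end

subsection \<open>The regret bound\<close>

theorem theorem4p4:
  fixes M :: "'w measure" and F :: "nat \<Rightarrow> 'w measure"
    and T :: nat
    and x \<mu>hat :: "nat \<Rightarrow> 'w \<Rightarrow> real ^ 'n"
    and \<mu>star :: "real ^ 'n"
    and \<epsilon> y :: "nat \<Rightarrow> 'w \<Rightarrow> real"
    and \<phi> \<phi>' :: "real \<Rightarrow> real" and D :: "real set"
    and A B \<kappa> K R \<sigma> \<delta> :: real
  assumes "prob_space M"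
    and features: "\<And>t \<omega>. t \<in> {1..T} \<Longrightarrow> \<omega> \<in> space M \<Longrightarrow> norm (x t \<omega>) \<le> A"
    and parameter: "norm \<mu>star \<le> B"
    and interval: "is_interval D" "{- B..B} \<subseteq> D"
    and activation: "activation_on D \<phi> \<phi>' \<kappa> K"
    and predictors: "\<And>\<omega>. \<omega> \<in> space M \<Longrightarrow> predictors_in D T (\<lambda>t. x t \<omega>) (\<lambda>t. \<mu>hat t \<omega>) \<mu>star"
    and protocol: "online_protocol M F T x \<mu>hat \<epsilon>"
    and noise_indep: "prob_space.indep_vars M (\<lambda>_. borel) \<epsilon> {1..T}"
    and noise_mean: "\<And>t. t \<in> {1..T} \<Longrightarrow> (\<integral>\<omega>. \<epsilon> t \<omega> \<partial>M) = 0"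
    and noise_bound: "\<And>t. t \<in> {1..T} \<Longrightarrow> measure M {\<omega> \<in> space M. \<bar>\<epsilon> t \<omega>\<bar> \<le> R} = 1"
    and noise_var: "\<And>t. t \<in> {1..T} \<Longrightarrow> (\<integral>\<omega>. (\<epsilon> t \<omega>)\<^sup>2 \<partial>M) \<le> \<sigma>\<^sup>2"
    and labels: "\<And>t \<omega>. t \<in> {1..T} \<Longrightarrow> \<omega> \<in> space M \<Longrightarrow> y t \<omega> = \<phi> (\<mu>star \<bullet> x t \<omega>) + \<epsilon> t \<omega>"
    and ftrl: "AE \<omega> in M. ftrl_iterates \<phi> (4 * A\<^sup>2 * K\<^sup>2 / \<kappa>)
                 (\<lambda>t. x t \<omega>) (\<lambda>t. y t \<omega>) T (\<lambda>t. \<mu>hat t \<omega>)"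
    and delta: "0 < \<delta>" "\<delta> < 1 / 2"
  shows "measure M {\<omega> \<in> space M.
           stoc_regret \<phi> (\<lambda>t. x t \<omega>) (\<lambda>t. y t \<omega>) (\<lambda>t. \<mu>hat t \<omega>) \<mu>star T
           \<le> 6 / \<kappa> * \<sigma>\<^sup>2 * real CARD('n)
                * ln ((4 * real CARD('n) * K\<^sup>2 + real T * \<kappa>\<^sup>2) / (4 * real CARD('n) * K\<^sup>2))
             + 8 * K\<^sup>2 * A\<^sup>2 * B\<^sup>2 / \<kappa>
             + 2 * (2 / \<kappa> + 5 * \<kappa> / (24 * K\<^sup>2)) * R\<^sup>2 * ln (1 / \<delta>)}
         \<ge> 1 - 2 * \<delta>"
proof -
  interpret prob_space M by fact
  have "0 \<le> B" using parameter norm_ge_zero order_trans by blast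
  then have "0 \<in> D" using interval(2) by auto
  then interpret interval_activation D \<phi> \<phi>' \<kappa> K
    using interval(1) activation by unfold_locales
  define d where "d = real CARD('n)"
  define \<Lambda> where "\<Lambda> = ln (1 / \<delta>)"
  define H where "H = ln ((4 * d * K\<^sup>2 + real T * \<kappa>\<^sup>2) / (4 * d * K\<^sup>2))"
  have d: "0 < d" by (simp add: d_def)
  have \<Lambda>: "0 < \<Lambda>" using delta by (simp add: \<Lambda>_def)
  have H: "0 \<le> H" using d K_pos unfolding H_def by (intro ln_ge_zero) simp
  let ?reg = "\<lambda>\<omega>. stoc_regret \<phi> (\<lambda>t. x t \<omega>) (\<lambda>t. y t \<omega>) (\<lambda>t. \<mu>hat t \<omega>) \<mu>star T"
  define rhs where "rhs = 6 / \<kappa> * \<sigma>\<^sup>2 * d * H + 8 * K\<^sup>2 * A\<^sup>2 * B\<^sup>2 / \<kappa>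
    + 2 * (2 / \<kappa> + 5 * \<kappa> / (24 * K\<^sup>2)) * R\<^sup>2 * \<Lambda>"
  note meas = online_protocol_measurable[OF protocol]
  have "1 - 2 * \<delta> \<le> prob {\<omega> \<in> space M. ?reg \<omega> \<le> rhs}"
  proof (cases "0 < A")
    \<comment> \<open>With \<open>A\<close> not positive all features of the rounds 1 to
      \<open>T\<close> are zero, hence so is the regret, and the right-hand side is
      nonnegative.\<close>
    case False
    have "?reg \<omega> = 0" if "\<omega> \<in> space M" for \<omega>
    proof -
      have "x t \<omega> = 0" if "t \<in> {1..T}" for t
        using features[OF that \<open>\<omega> \<in> space M\<close>] False by (metis norm_le_zero_iff not_less order_trans)
      then show ?thesis by (simp add: stoc_regret_def glm_loss_def)
    qed
    moreover have "0 \<le> rhs"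
      unfolding rhs_def using d H \<Lambda> kappa_pos K_pos by (intro add_nonneg_nonneg) auto
    ultimately have "{\<omega> \<in> space M. ?reg \<omega> \<le> rhs} = space M" by auto
    then show ?thesis using delta by (simp add: prob_space)
  next
    case A: True
    \<comment> \<open>This is \<open>2 * lam / \<kappa>\<close> for the prescribed regularization
      parameter.\<close>
    define c where "c = 8 * A\<^sup>2 * K\<^sup>2 / \<kappa>\<^sup>2"
    have c: "0 < c" using A K_pos kappa_pos by (simp add: c_def)
    define u where "u t \<omega> = x t \<omega> \<bullet> (\<mu>hat t \<omega> - \<mu>star)" for t \<omega>
    define w where "w t \<omega> = leverage c (\<lambda>\<tau>. x \<tau> \<omega>) t" for t \<omega>
    have u: "u t \<in> borel_measurable (F (t - 1))" if t: "t \<in> {1..T}" for t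
    proof -
      note [measurable] = meas(1,2)[OF t]
      show ?thesis unfolding u_def[abs_def] by measurable
    qed
    \<comment> \<open>The leverage of round \<open>t\<close> involves the features of rounds 1 to
      \<open>t\<close> only, all of which are known before the noise of that round.\<close>
    have w: "w t \<in> borel_measurable (F (t - 1))" if t: "t \<in> {1..T}" for t
      unfolding w_def[abs_def]
    proof (rule borel_measurable_leverage)
      fix \<tau> assume \<tau>: "\<tau> \<in> {1..t}"
      then have "\<tau> \<in> {1..T}" using t by auto
      then have "x \<tau> \<in> borel_measurable (F (\<tau> - 1))" by (rule meas(1))
      then show "x \<tau> \<in> borel_measurable (F (t - 1))"
        by (rule online_protocol_measurable_le[OF protocol, rotated]) (use \<tau> in auto)
    qed
    have w_nonneg: "0 \<le> w t \<omega>" if "t \<in> {1..T}" for t \<omega>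
      unfolding w_def using that c by (intro leverage_nonneg) auto
    have w_le: "w t \<omega> \<le> \<kappa>\<^sup>2 / (8 * K\<^sup>2)" if "t \<in> {1..T}" "\<omega> \<in> space M" for t \<omega>
    proof -
      have "w t \<omega> \<le> A\<^sup>2 / c"
        unfolding w_def using that c features by (intro leverage_le) auto
      also have "\<dots> = \<kappa>\<^sup>2 / (8 * K\<^sup>2)" using A by (simp add: c_def)
      finally show ?thesis .
    qed
    have w_sum: "(\<Sum>t=1..T. w t \<omega>) \<le> d * H" if "\<omega> \<in> space M" for \<omega>
    proof -
      have "(\<Sum>t=1..T. w t \<omega>) \<le> d * ln (1 + real T * A\<^sup>2 / (c * d))"
        unfolding w_def d_def using c features that by (intro sum_leverage_le) auto
      also have "\<dots> \<le> d * H"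
      proof -
        have "real T * A\<^sup>2 / (c * d) = real T * \<kappa>\<^sup>2 / (8 * d * K\<^sup>2)"
          using A by (simp add: c_def)
        \<comment> \<open>The elliptical potential yields 8 in the denominator; it is relaxed to the
          4 of the claim.\<close>
        also have "\<dots> \<le> real T * \<kappa>\<^sup>2 / (4 * d * K\<^sup>2)"
          using d K_pos by (intro divide_left_mono) auto
        finally have "1 + real T * A\<^sup>2 / (c * d) \<le> (4 * d * K\<^sup>2 + real T * \<kappa>\<^sup>2) / (4 * d * K\<^sup>2)"
          using d K_pos by (simp add: add_divide_distrib)
        moreover have "0 < 1 + real T * A\<^sup>2 / (c * d)"
          using c d by (intro add_pos_nonneg) auto
        ultimately show ?thesis
          unfolding H_def using d by (intro mult_left_mono ln_mono) auto
      qed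
      finally show ?thesis .
    qed
    have bound: "AE \<omega> in M. \<bar>\<epsilon> t \<omega>\<bar> \<le> R" if t: "t \<in> {1..T}" for t
    proof -
      note [measurable] = meas(4)[OF t]
      have "{\<omega> \<in> space M. \<bar>\<epsilon> t \<omega>\<bar> \<le> R} \<in> events" by measurable
      then show ?thesis using noise_bound[OF t] by (simp add: prob_Collect_eq_1)
    qed
    define G1 where "G1 = {\<omega> \<in> space M. (\<Sum>t=1..T. \<epsilon> t \<omega> * u t \<omega>)
      \<le> \<kappa> / 4 * (\<Sum>t=1..T. (u t \<omega>)\<^sup>2) + 2 * (R\<^sup>2 * \<Lambda>) / \<kappa>}"
    define G2 where "G2 = {\<omega> \<in> space M. (\<Sum>t=1..T. (\<epsilon> t \<omega>)\<^sup>2 * w t \<omega>)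
      \<le> 2 * \<sigma>\<^sup>2 * (\<Sum>t=1..T. w t \<omega>) + \<kappa>\<^sup>2 / (8 * K\<^sup>2) * R\<^sup>2 * \<Lambda>}"
    have G1: "1 - \<delta> \<le> prob G1"
      unfolding G1_def \<Lambda>_def
      by (rule martingale_noise_bound[OF protocol u bound noise_mean kappa_pos delta(1)])
    have G2: "1 - \<delta> \<le> prob G2"
      unfolding G2_def \<Lambda>_def using K_pos kappa_pos
      by (intro squared_noise_bound[OF protocol w w_nonneg w_le bound noise_var _ _ delta(1)]) auto
    have "AE \<omega> in M. \<omega> \<in> G1 \<inter> G2 \<longrightarrow> ?reg \<omega> \<le> rhs"
      using ftrl AE_space
    proof eventually_elim
      case (elim \<omega>)
      show ?case
      proof
        assume G: "\<omega> \<in> G1 \<inter> G2"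
        let ?N = "\<Sum>t=1..T. (\<epsilon> t \<omega>)\<^sup>2 * w t \<omega>"
        have "?reg \<omega> \<le> 2 * (4 * A\<^sup>2 * K\<^sup>2 / \<kappa>) * B\<^sup>2 + 2 / \<kappa> * ?N + 2 * (R\<^sup>2 * \<Lambda>) / \<kappa>"
          unfolding w_def c_def
        proof (rule ftrl_regret_le_noise[OF A _ parameter elim(1) predictors[OF elim(2)]])
          show "(\<Sum>t=1..T. \<epsilon> t \<omega> * (x t \<omega> \<bullet> (\<mu>hat t \<omega> - \<mu>star)))
            \<le> \<kappa> / 4 * (\<Sum>t=1..T. (x t \<omega> \<bullet> (\<mu>hat t \<omega> - \<mu>star))\<^sup>2) + 2 * (R\<^sup>2 * \<Lambda>) / \<kappa>"
            using G by (simp add: G1_def u_def)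
        qed (use features labels elim(2) in auto)
        also have "2 / \<kappa> * ?N \<le> 2 / \<kappa> * (2 * \<sigma>\<^sup>2 * (d * H) + \<kappa>\<^sup>2 / (8 * K\<^sup>2) * R\<^sup>2 * \<Lambda>)"
        proof (rule mult_left_mono)
          have "2 * \<sigma>\<^sup>2 * (\<Sum>t=1..T. w t \<omega>) \<le> 2 * \<sigma>\<^sup>2 * (d * H)"
            using w_sum[OF elim(2)] by (intro mult_left_mono) auto
          moreover have "?N \<le> 2 * \<sigma>\<^sup>2 * (\<Sum>t=1..T. w t \<omega>) + \<kappa>\<^sup>2 / (8 * K\<^sup>2) * R\<^sup>2 * \<Lambda>"
            using G by (simp add: G2_def)
          ultimately show "?N \<le> 2 * \<sigma>\<^sup>2 * (d * H) + \<kappa>\<^sup>2 / (8 * K\<^sup>2) * R\<^sup>2 * \<Lambda>" by linarith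
        qed (use kappa_pos in simp)
        also have "\<dots> = 4 / \<kappa> * \<sigma>\<^sup>2 * d * H + \<kappa> / (4 * K\<^sup>2) * R\<^sup>2 * \<Lambda>"
          using kappa_pos K_pos by (simp add: field_simps power2_eq_square)
        finally have *: "?reg \<omega> \<le> 8 * K\<^sup>2 * A\<^sup>2 * B\<^sup>2 / \<kappa> + (4 / \<kappa> * \<sigma>\<^sup>2 * d * H
          + (\<kappa> / (4 * K\<^sup>2) * R\<^sup>2 * \<Lambda> + 2 / \<kappa> * (R\<^sup>2 * \<Lambda>)))"
          by (simp add: mult_ac)
        \<comment> \<open>The constants obtained leave slack: 4 against 6 in the variance term, and
          in the deviation term 1/4 against 5/12 for \<kappa> / K^2 and 2 against 4 for 1 /
          \<kappa>.\<close>
        have "4 / \<kappa> * \<sigma>\<^sup>2 * d * H \<le> 6 / \<kappa> * \<sigma>\<^sup>2 * d * H"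
          using d H kappa_pos by (intro mult_right_mono divide_right_mono) auto
        moreover have "\<kappa> / (4 * K\<^sup>2) * R\<^sup>2 * \<Lambda> + 2 / \<kappa> * (R\<^sup>2 * \<Lambda>)
          \<le> 2 * (2 / \<kappa> + 5 * \<kappa> / (24 * K\<^sup>2)) * R\<^sup>2 * \<Lambda>"
        proof -
          have "(\<kappa> / (4 * K\<^sup>2) + 2 / \<kappa>) * (R\<^sup>2 * \<Lambda>)
            \<le> 2 * (2 / \<kappa> + 5 * \<kappa> / (24 * K\<^sup>2)) * (R\<^sup>2 * \<Lambda>)"
          proof (rule mult_right_mono)
            define q r where "q = 2 / \<kappa>" and "r = \<kappa> / K\<^sup>2"
            have r: "\<kappa> / (4 * K\<^sup>2) = r / 4" "5 * \<kappa> / (24 * K\<^sup>2) = 5 / 24 * r" "2 / \<kappa> = q"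
              by (simp_all add: q_def r_def)
            have "0 \<le> r" "0 \<le> q" using kappa_pos by (simp_all add: q_def r_def)
            then show "\<kappa> / (4 * K\<^sup>2) + 2 / \<kappa> \<le> 2 * (2 / \<kappa> + 5 * \<kappa> / (24 * K\<^sup>2))"
              unfolding r by (simp add: algebra_simps)
          qed (use \<Lambda> in simp)
          then show ?thesis by (simp add: algebra_simps)
        qed
        ultimately show "?reg \<omega> \<le> rhs" using * unfolding rhs_def by linarith
      qed
    qed
    \<comment> \<open>A set that is not an event has measure 0 by convention, so the lower bound 1 -
      \<delta> > 0 forces both sets to be events.\<close>
    moreover have G_events: "G1 \<in> events" "G2 \<in> events"
      using G1 G2 delta measure_notin_sets[of G1 M] measure_notin_sets[of G2 M] by force+
    moreover have "{\<omega> \<in> space M. ?reg \<omega> \<le> rhs} \<in> events"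
      by (intro borel_measurable_le borel_measurable_const
          borel_measurable_stoc_regret[where e = \<epsilon>] meas(4) meas(5)[OF _ meas(1)] meas(5)[OF _ meas(2)]
          predictors labels)
    ultimately have "prob (G1 \<inter> G2) \<le> prob {\<omega> \<in> space M. ?reg \<omega> \<le> rhs}"
      by (intro finite_measure_mono_AE) (auto elim: eventually_mono)
    then show ?thesis
      using prob_Int_ge[OF G_events] G1 G2 by linarith
  qed
  then show ?thesis unfolding rhs_def H_def \<Lambda>_def d_def .
qed

end
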